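(* Let $\mathcal{Y}$ be a target domain and let $\ell:\mathbb{R}\times\mathcal{Y}\to\mathbb{R}$ be a loss function that is convex in its first argument and non-negative. Let $\lambda>0$. For any rank parameter $d\ge1$, any sample size $m\geq 2^{7}d$, any budget $B<\frac{3}{50}d^2$, and for any budgeted algorithm with budget $B$, there exist a kernel matrix $K\in \mathcal{K}_{2d,m}$ and target values $y_1,\ldots,y_m$ in $\mathcal{Y}$ such that the coefficient vector $\boldsymbol{\alpha}\in\mathbb{R}^m$ returned by the algorithm satisfies \[ \Delta_\ell(m,\boldsymbol{\alpha},K,\lambda,y) \;\geq\; \frac{1}{60}\,\lambda d\,\min_{p\in \left[\frac{1}{2},2\right]}\ \max_{y\in\mathcal{Y}}\ (2u_1^*-u_2^* )^2 , \] where, for given $p$ and $y$, \[ u^*_1 = \operatorname*{argmin}_{u\in\mathbb{R}}\ \ell(u,y)+p\lambda d u^2 \qquad\text{and}\qquad u_2^* = \operatorname*{argmin}_{u\in\mathbb{R}}\ \ell(u,y)+\frac{p\lambda d}{2} u^2~. \]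
   Context: For a loss $\ell$, an $m\times m$ kernel matrix $K$, a vector $\boldsymbol{\alpha}\in\mathbb{R}^m$, targets $y=(y_1,\dots,y_m)$ and $\lambda>0$, with $\boldsymbol{e}_1,\dots,\boldsymbol{e}_m$ the standard basis of $\mathbb{R}^m$, \[ \Delta_\ell(m,\boldsymbol{\alpha},K,\lambda,y)=\left(\frac{1}{m}\sum_{t=1}^{m}\ell\left(\boldsymbol{\alpha}^\top K \boldsymbol{e}_t,y_t\right)+\frac{\lambda}{2}\boldsymbol{\alpha}^\top K \boldsymbol{\alpha}\right) - \min_{\boldsymbol{a}\in\mathbb{R}^m}\left(\frac{1}{m}\sum_{t=1}^{m}\ell\left(\boldsymbol{a}^\top K \boldsymbol{e}_t,y_t\right)+\frac{\lambda}{2}\boldsymbol{a}^\top K \boldsymbol{a}\right). \] Class $\mathcal{K}_{d,m}$: let $\mathcal{K}'_{d,m}$ be the class of all block-diagonal $m\times m$ matrices composed of at most $d$ (square, diagonal) blocks, with all entries equal to $1$ within each block and $0$ outside the blocks. Then $\mathcal{K}_{d,m}$ is the set of $K\in\{0,1\}^{m\times m}$ for which there exist a permutation $\pi$ of $\{1,\dots,m\}$ and $K'\in\mathcal{K}'_{d,m}$ with $K_{i,j}=K'_{\pi(i),\pi(j)}$ for all $i,j$. The class $\mathcal{K}_{2d,m}$ is the one with $2d$ in place of $d$. Budgeted algorithm: the algorithm is given the target values $y_1,\dots,y_m$ but not the kernel matrix $K$. It may (adaptively) query at most $B$ entries of $K$, and then returns a coefficient vector $\boldsymbol{\alpha}\in\mathbb{R}^m$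 based on this information. If the algorithm is randomized, $\Delta_\ell$ of the returned vector is understood in expectation over the algorithm's internal randomness. *)

theory Defs
  imports "HOL-Probability.Probability" "Jordan_Normal_Form.Matrix"
begin

no_notation inner (infix \<open>\<bullet>\<close> 70)
no_notation vec_nth (infixl \<open>$\<close> 90)

text \<open>Indices run over \<open>0, \<dots>, m - 1\<close> instead of \<open>1, \<dots>, m\<close>.\<close>

definition objective ::
    "(real \<Rightarrow> 'y \<Rightarrow> real) \<Rightarrow> nat \<Rightarrow> real mat \<Rightarrow> real \<Rightarrow> 'y list \<Rightarrow> real vec \<Rightarrow> real" where
  "objective loss m K lam y a =
     1 / real m * (\<Sum>t<m. loss (a \<bullet> (K *\<^sub>v unit_vec m t)) (y ! t)) + lam / 2 * (a \<bullet> (K *\<^sub>v a))"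

text \<open>The infimum is a minimum, and hence \<open>Delta\<close> is nonnegative, whenever \<open>K\<close> is positive
  semidefinite, \<open>lam > 0\<close>, and the loss is convex in its first argument and nonnegative.\<close>

definition Delta ::
    "(real \<Rightarrow> 'y \<Rightarrow> real) \<Rightarrow> nat \<Rightarrow> real vec \<Rightarrow> real mat \<Rightarrow> real \<Rightarrow> 'y list \<Rightarrow> real" where
  "Delta loss m \<alpha> K lam y =
     objective loss m K lam y \<alpha> - (INF a\<in>carrier_vec m. objective loss m K lam y a)"

definition block_kernels :: "nat \<Rightarrow> nat \<Rightarrow> real mat set" where
  "block_kernels d m =
     {diag_block_mat (map (\<lambda>n. mat n n (\<lambda>_. 1)) ns) | ns.
        length ns \<le> d \<and> (\<forall>n\<in>set ns. 0 < n) \<and> sum_list ns = m}"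

definition kernel_class :: "nat \<Rightarrow> nat \<Rightarrow> real mat set" where
  "kernel_class d m =
     {mat m m (\<lambda>(i, j). K' $$ (\<pi> i, \<pi> j)) | \<pi> K'. \<pi> permutes {..<m} \<and> K' \<in> block_kernels d m}"

text \<open>A deterministic adaptive algorithm, for fixed targets, is a decision tree:
  \<open>Query i j f\<close> reads the entry \<open>(i, j)\<close> of the kernel matrix and continues with the tree selected by
  its value. The branching is infinite, but every path is finite.\<close>

datatype query_tree =
    Return "real vec"
  | Query nat nat "real \<Rightarrow> query_tree"

primrec returned :: "query_tree \<Rightarrow> real mat \<Rightarrow> real vec" where
  "returned (Return \<alpha>) K = \<alpha>"
| "returned (Query i j f) K = returned (f (K $$ (i, j))) K"

primrec queried :: "query_tree \<Rightarrow> real mat \<Rightarrow> (nat \<times> nat) set" where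
  "queried (Return \<alpha>) K = {}"
| "queried (Query i j f) K = insert (i, j) (queried (f (K $$ (i, j))) K)"

text \<open>A randomized algorithm draws a seed \<open>\<omega>\<close> from a probability space \<open>M\<close>, and then runs the
  deterministic algorithm \<open>A \<omega> y\<close>, which depends on the seed and on the targets \<open>y\<close>; deterministic
  algorithms are those ignoring the seed. The budget counts distinct entries, so that asking again for
  a known entry is free. Only runs on matrices from the class \<open>Ks\<close> of admissible kernel matrices are
  constrained. The measurability condition makes the expectation over the seed meaningful.\<close>

definition budgeted_algorithm ::
    "'w measure \<Rightarrow> ('w \<Rightarrow> 'y list \<Rightarrow> query_tree) \<Rightarrow> nat \<Rightarrow> 'y set \<Rightarrow> real mat set \<Rightarrow> nat \<Rightarrow> bool" where
  "budgeted_algorithm M A m Y Ks B \<longleftrightarrow>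
     prob_space M \<and>
     (\<forall>y K. length y = m \<and> set y \<subseteq> Y \<and> K \<in> Ks \<longrightarrow>
        (\<forall>\<omega>\<in>space M.
           queried (A \<omega> y) K \<subseteq> {..<m} \<times> {..<m} \<and>
           card (queried (A \<omega> y) K) \<le> B \<and>
           returned (A \<omega> y) K \<in> carrier_vec m) \<and>
        (\<forall>i<m. (\<lambda>\<omega>. returned (A \<omega> y) K $ i) \<in> borel_measurable M))"

text \<open>\<open>Delta\<close> is nonnegative on the kernels considered, so its expectation is taken as a
  nonnegative integral; this gives \<open>\<infinity>\<close>, and not \<open>0\<close>, if \<open>Delta\<close> is not integrable.\<close>

definition expected_Delta ::
    "(real \<Rightarrow> 'y \<Rightarrow> real) \<Rightarrow> nat \<Rightarrow> 'w measure \<Rightarrow> ('w \<Rightarrow> 'y list \<Rightarrow> query_tree) \<Rightarrow>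
       real mat \<Rightarrow> real \<Rightarrow> 'y list \<Rightarrow> ennreal" where
  "expected_Delta loss m M A K lam y =
     (\<integral>\<^sup>+\<omega>. ennreal (Delta loss m (returned (A \<omega> y) K) K lam y) \<partial>M)"

text \<open>For a convex, nonnegative loss and \<open>lam, p, d > 0\<close> both minimizers below exist and are unique.\<close>

definition u1 :: "(real \<Rightarrow> 'y \<Rightarrow> real) \<Rightarrow> real \<Rightarrow> nat \<Rightarrow> real \<Rightarrow> 'y \<Rightarrow> real" where
  "u1 loss lam d p y = (ARG_MIN (\<lambda>u. loss u y + p * lam * real d * u\<^sup>2) u. True)"

definition u2 :: "(real \<Rightarrow> 'y \<Rightarrow> real) \<Rightarrow> real \<Rightarrow> nat \<Rightarrow> real \<Rightarrow> 'y \<Rightarrow> real" where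
  "u2 loss lam d p y = (ARG_MIN (\<lambda>u. loss u y + p * lam * real d / 2 * u\<^sup>2) u. True)"

definition gap :: "(real \<Rightarrow> 'y \<Rightarrow> real) \<Rightarrow> real \<Rightarrow> nat \<Rightarrow> real \<Rightarrow> 'y \<Rightarrow> real" where
  "gap loss lam d p y = (2 * u1 loss lam d p y - u2 loss lam d p y)\<^sup>2"

end

theory Submission
  imports Defs
begin

text \<open>A constant target \<open>y\<close> makes the objective of a block kernel separate into one penalised problem
  per block, in the sum of the coefficients over that block. By strong convexity \<open>Delta\<close> is then at
  least the sum of \<open>lam / 2\<close> times the squared distances of these sums to their optima. Two blocks of
  size \<open>m / (2 p d)\<close> have optimum \<open>u1\<close> each, and their union has optimum \<open>u2\<close>; whatever the
  coefficients are, merged and split together cost at least \<open>lam / 6 * (2 * u1 - u2)\<^sup>2\<close>.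

  For \<open>d \<ge> 2\<close> the hard kernel has \<open>k = d - 1\<close> left cells and \<open>k\<close> right cells, matched by a random
  permutation; each matched pair is merged or split at random, and the remaining points form one more
  block. Unless the algorithm queries an entry between a left cell and its partner, it cannot tell
  whether the pair is merged. A switching argument shows that of \<open>B\<close> queries the expected number of
  hits is at most \<open>6 B / k\<close>, so that at least \<open>d / 5\<close> pairs remain undetected. For \<open>d = 1\<close> the budget
  is zero, and three kernels suffice.\<close>

section \<open>Penalised convex minimisation and block kernels\<close>

lemma penalised_arg_min_exists:
  fixes f :: "real \<Rightarrow> real"
  assumes "convex_on UNIV f" and nonneg: "\<And>u. 0 \<le> f u" and "0 < \<mu>"
  shows "\<exists>w. is_arg_min (\<lambda>u. f u + \<mu> * u\<^sup>2) (\<lambda>_. True) w"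
proof -
  let ?F = "\<lambda>u. f u + \<mu> * u\<^sup>2"
  \<comment> \<open>The radius at which the penalty alone exceeds \<open>f 0\<close>: no point
    outside \<open>{-r..r}\<close> beats 0, and compactness settles the rest.\<close>
  define r where "r = sqrt ((f 0 + 1) / \<mu>)"
  have r: "0 \<le> r" "\<mu> * r\<^sup>2 = f 0 + 1"
    using nonneg[of 0] \<open>0 < \<mu>\<close> by (auto simp: r_def)
  have "continuous_on UNIV f"
    using convex_on_continuous[OF open_UNIV assms(1)] .
  then have "continuous_on {-r..r} ?F"
    by (intro continuous_intros) (auto intro: continuous_on_subset)
  then obtain w where w: "w \<in> {-r..r}" "\<And>u. u \<in> {-r..r} \<Longrightarrow> ?F w \<le> ?F u"
    using continuous_attains_inf[of "{-r..r}" ?F] r(1) by auto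
  have "?F w \<le> ?F u" for u
  proof (cases "u \<in> {-r..r}")
    case False
    then have "r\<^sup>2 \<le> u\<^sup>2"
      using r(1) by (auto simp: abs_le_square_iff[symmetric])
    then have "f 0 + 1 \<le> \<mu> * u\<^sup>2"
      using r(2) \<open>0 < \<mu>\<close> by (metis mult_left_mono less_imp_le)
    moreover have "?F w \<le> ?F 0"
      using w(2)[of 0] r(1) by auto
    ultimately show ?thesis
      using nonneg[of u] by simp
  qed (use w in blast)
  then show ?thesis
    by (auto simp: is_arg_min_linorder)
qed

text \<open>Comparing \<open>w\<close> with a point on the segment towards \<open>u\<close> gives
  the bound up to a factor \<open>z\<close>, which disappears as \<open>z\<close> tends to
  1.\<close>

lemma penalised_arg_min_strong:
  fixes f :: "real \<Rightarrow> real"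
  assumes "convex_on UNIV f" and min: "is_arg_min (\<lambda>u. f u + \<mu> * u\<^sup>2) (\<lambda>_. True) w"
  shows "\<mu> * (u - w)\<^sup>2 \<le> (f u + \<mu> * u\<^sup>2) - (f w + \<mu> * w\<^sup>2)"
proof (rule field_le_mult_one_interval)
  fix z :: real
  assume z: "0 < z" "z < 1"
  define v where "v = z * w + (1 - z) * u"
  have "f v \<le> z * f w + (1 - z) * f u"
    using assms(1) z unfolding convex_on_def v_def by auto
  moreover have "f w + \<mu> * w\<^sup>2 \<le> f v + \<mu> * v\<^sup>2"
    using min by (auto simp: is_arg_min_linorder)
  moreover have "v\<^sup>2 = z * w\<^sup>2 + (1 - z) * u\<^sup>2 - z * (1 - z) * (u - w)\<^sup>2"
    by (simp add: v_def power2_eq_square algebra_simps)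
  ultimately have "f w + \<mu> * w\<^sup>2 \<le> z * f w + (1 - z) * f u
      + \<mu> * (z * w\<^sup>2 + (1 - z) * u\<^sup>2 - z * (1 - z) * (u - w)\<^sup>2)"
    by simp
  then have "(1 - z) * (z * (\<mu> * (u - w)\<^sup>2)) \<le> (1 - z) * ((f u + \<mu> * u\<^sup>2) - (f w + \<mu> * w\<^sup>2))"
    by (simp add: algebra_simps)
  then show "z * (\<mu> * (u - w)\<^sup>2) \<le> (f u + \<mu> * u\<^sup>2) - (f w + \<mu> * w\<^sup>2)"
    using z by simp
qed

section \<open>Kernels of labellings\<close>

text \<open>Up to a permutation of the points, a block kernel only records which points share a
  block, so a labelling encodes it without block sizes or their order.\<close>

definition label_kernel :: "nat \<Rightarrow> (nat \<Rightarrow> nat) \<Rightarrow> real mat" where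
  "label_kernel m c = mat m m (\<lambda>(i, j). if c i = c j then 1 else 0)"

fun block_index :: "nat list \<Rightarrow> nat \<Rightarrow> nat" where
  "block_index [] i = 0"
| "block_index (n # ns) i = (if i < n then 0 else Suc (block_index ns (i - n)))"

lemma block_index_less: "i < sum_list ns \<Longrightarrow> block_index ns i < length ns"
  by (induction ns arbitrary: i) auto

lemma card_block_index:
  "r < length ns \<Longrightarrow> card {i \<in> {..<sum_list ns}. block_index ns i = r} = ns ! r"
proof (induction ns arbitrary: r)
  case (Cons n ns)
  show ?case
  proof (cases r)
    case 0
    then have "{i \<in> {..<sum_list (n # ns)}. block_index (n # ns) i = r} = {..<n}"
      by auto
    then show ?thesis
      using 0 by simp
  next
    case (Suc q)
    have "{i \<in> {..<sum_list (n # ns)}. block_index (n # ns) i = r}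
        = (\<lambda>i. i + n) ` {i \<in> {..<sum_list ns}. block_index ns i = q}" (is "?L = ?R")
    proof (intro equalityI subsetI)
      fix i assume i: "i \<in> ?L"
      then have "n \<le> i"
        using Suc by (auto split: if_splits)
      then show "i \<in> ?R"
        using i Suc by (intro image_eqI[where x = "i - n"]) auto
    qed (use Suc in auto)
    then show ?thesis
      using Cons Suc by (simp add: card_image)
  qed
qed simp

lemma diag_block_ones_index:
  assumes "i < sum_list ns" "j < sum_list ns"
  shows "diag_block_mat (map (\<lambda>n. mat n n (\<lambda>_. 1 :: real)) ns) $$ (i, j)
    = (if block_index ns i = block_index ns j then 1 else 0)"
  using assms
proof (induction ns arbitrary: i j)
  case (Cons n ns)
  then show ?case
    by (auto simp: Let_def dim_diag_block_mat o_def)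
qed simp

text \<open>One block is taken per label, of the size of its fibre. Placed consecutively, the blocks
  give a labelling with the same fibre sizes as \<open>c\<close>, and two such labellings differ by
  a permutation.\<close>

lemma label_kernel_in_kernel_class:
  assumes "card (c ` {..<m}) \<le> D"
  shows "label_kernel m c \<in> kernel_class D m"
proof -
  let ?fib = "\<lambda>v. {i \<in> {..<m}. c i = v}"
  define vs where "vs = sorted_list_of_set (c ` {..<m})"
  define ns where "ns = map (\<lambda>v. card (?fib v)) vs"
  have vs: "set vs = c ` {..<m}" "distinct vs"
    by (auto simp: vs_def)
  have sum_ns: "sum_list ns = m"
    using sum.image_gen[of "{..<m}" "\<lambda>_. 1 :: nat" c] vs
    by (simp add: ns_def sum_list_distinct_conv_sum_set)
  have pos: "\<forall>n\<in>set ns. 0 < n"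
    using vs by (auto simp: ns_def card_gt_0_iff)
  have len: "length ns \<le> D"
    using assms vs distinct_card[OF vs(2)] by (simp add: ns_def)
  define f where "f = (\<lambda>i. vs ! block_index ns i)"
  have fib: "card {i \<in> {..<m}. f i = v} = card (?fib v)" for v
  proof (cases "v \<in> set vs")
    case True
    then obtain r where r: "r < length vs" "v = vs ! r"
      by (auto simp: in_set_conv_nth)
    have "{i \<in> {..<m}. f i = v} = {i \<in> {..<sum_list ns}. block_index ns i = r}"
      using r vs(2) block_index_less[of _ ns] sum_ns
      by (auto simp: f_def nth_eq_iff_index_eq ns_def)
    then show ?thesis
      using r card_block_index[of r ns] by (simp add: ns_def)
  next
    case False
    moreover have "f i \<in> set vs" if "i < m" for i
      using that block_index_less[of i ns] sum_ns by (auto simp: f_def ns_def)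
    ultimately have "{i \<in> {..<m}. f i = v} = {}" "?fib v = {}"
      using vs by auto
    then show ?thesis
      by (simp only: card.empty)
  qed
  have count: "count (image_mset g (mset_set {..<m})) v = card {i \<in> {..<m}. g i = v}"
    for g :: "nat \<Rightarrow> nat" and v
    by (simp add: count_image_mset Int_def vimage_def conj_commute)
  \<comment> \<open>Equal fibre sizes, read as equality of the multisets of labels, produce the
    permutation.\<close>
  have "image_mset c (mset_set {..<m}) = image_mset f (mset_set {..<m})"
    by (rule multiset_eqI) (simp only: count fib)
  then obtain \<pi> where \<pi>: "\<pi> permutes {..<m}" "\<forall>i\<in>{..<m}. c i = f (\<pi> i)"
    using image_mset_eq_implies_permutes[of "{..<m}" c f] by auto
  have "label_kernel m c
      = mat m m (\<lambda>(i, j). diag_block_mat (map (\<lambda>n. mat n n (\<lambda>_. 1)) ns) $$ (\<pi> i, \<pi> j))"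
  proof (rule eq_matI; simp add: label_kernel_def)
    fix i j assume ij: "i < m" "j < m"
    then have lt: "\<pi> i < m" "\<pi> j < m"
      using permutes_in_image[OF \<pi>(1)] by auto
    have "c i = c j \<longleftrightarrow> block_index ns (\<pi> i) = block_index ns (\<pi> j)"
      using \<pi>(2) ij vs(2) lt block_index_less[of _ ns] sum_ns
      by (auto simp: f_def nth_eq_iff_index_eq ns_def)
    then show "(c i = c j \<longrightarrow>
          diag_block_mat (map (\<lambda>n. mat n n (\<lambda>_. 1)) ns) $$ (\<pi> i, \<pi> j) = (1::real)) \<and>
        (c i \<noteq> c j \<longrightarrow> diag_block_mat (map (\<lambda>n. mat n n (\<lambda>_. 1)) ns) $$ (\<pi> i, \<pi> j) = (0::real))"
      using lt sum_ns by (simp add: diag_block_ones_index)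
  qed
  then show ?thesis
    using \<pi>(1) len pos sum_ns unfolding kernel_class_def block_kernels_def by blast
qed

section \<open>Separation of the objective into blocks\<close>

definition label_sum :: "nat \<Rightarrow> (nat \<Rightarrow> nat) \<Rightarrow> real vec \<Rightarrow> nat \<Rightarrow> real" where
  "label_sum m c a v = (\<Sum>i\<in>{i \<in> {..<m}. c i = v}. a $ i)"

lemma label_kernel_prediction:
  assumes "a \<in> carrier_vec m" "t < m"
  shows "a \<bullet> (label_kernel m c *\<^sub>v unit_vec m t) = label_sum m c a (c t)"
proof -
  have "a \<bullet> (label_kernel m c *\<^sub>v unit_vec m t) = (\<Sum>i<m. if c i = c t then a $ i else 0)"
    using assms unfolding scalar_prod_def[of a]
    by (auto simp: label_kernel_def lessThan_atLeast0 intro!: sum.cong)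
  then show ?thesis
    by (simp add: label_sum_def sum.If_cases Int_def)
qed

lemma label_kernel_quadratic:
  assumes "a \<in> carrier_vec m"
  shows "a \<bullet> (label_kernel m c *\<^sub>v a) = (\<Sum>v\<in>c ` {..<m}. (label_sum m c a v)\<^sup>2)"
proof -
  have "(label_kernel m c *\<^sub>v a) $ i = label_sum m c a (c i)" if "i < m" for i
  proof -
    have "(label_kernel m c *\<^sub>v a) $ i = (\<Sum>j<m. if c j = c i then a $ j else 0)"
      using assms that unfolding mult_mat_vec_def
      by (auto simp: scalar_prod_def label_kernel_def lessThan_atLeast0 intro!: sum.cong)
    then show ?thesis
      by (simp add: label_sum_def sum.If_cases Int_def)
  qed
  then have "a \<bullet> (label_kernel m c *\<^sub>v a) = (\<Sum>i<m. a $ i * label_sum m c a (c i))"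
    using assms by (auto simp: scalar_prod_def label_kernel_def lessThan_atLeast0 intro!: sum.cong)
  also have "\<dots> = (\<Sum>v\<in>c ` {..<m}. \<Sum>i\<in>{i \<in> {..<m}. c i = v}. a $ i * label_sum m c a (c i))"
    by (rule sum.image_gen) simp
  also have "\<dots> = (\<Sum>v\<in>c ` {..<m}. (label_sum m c a v)\<^sup>2)"
    by (intro sum.cong refl)
      (simp add: power2_eq_square label_sum_def flip: sum_distrib_right)
  finally show ?thesis .
qed

lemma objective_label_kernel:
  assumes "a \<in> carrier_vec m"
  shows "objective loss m (label_kernel m c) lam (replicate m y) a =
    (\<Sum>v\<in>c ` {..<m}. real (card {i \<in> {..<m}. c i = v}) / real m * loss (label_sum m c a v) y
       + lam / 2 * (label_sum m c a v)\<^sup>2)"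
proof -
  have "(\<Sum>t<m. loss (a \<bullet> (label_kernel m c *\<^sub>v unit_vec m t)) (replicate m y ! t))
      = (\<Sum>t<m. loss (label_sum m c a (c t)) y)"
    using assms by (intro sum.cong) (auto simp: label_kernel_prediction)
  also have "\<dots> = (\<Sum>v\<in>c ` {..<m}. \<Sum>i\<in>{i \<in> {..<m}. c i = v}. loss (label_sum m c a (c i)) y)"
    by (rule sum.image_gen) simp
  also have "\<dots> = (\<Sum>v\<in>c ` {..<m}. real (card {i \<in> {..<m}. c i = v}) * loss (label_sum m c a v) y)"
    by (intro sum.cong refl) simp
  finally show ?thesis
    using assms unfolding objective_def label_kernel_quadratic[OF assms]
    by (simp add: sum.distrib sum_distrib_left sum_divide_distrib)
qed

text \<open>Spreading each value evenly over its block shows that all block sums can be prescribed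
  independently.\<close>

lemma label_sum_attains:
  assumes "v \<in> c ` {..<m}"
  shows "label_sum m c (vec m (\<lambda>i. w (c i) / real (card {j \<in> {..<m}. c j = c i}))) v = w v"
proof -
  have "0 < card {i \<in> {..<m}. c i = v}"
    using assms by (auto simp: card_gt_0_iff)
  moreover have "label_sum m c (vec m (\<lambda>i. w (c i) / real (card {j \<in> {..<m}. c j = c i}))) v
      = (\<Sum>i\<in>{i \<in> {..<m}. c i = v}. w v / real (card {j \<in> {..<m}. c j = v}))"
    unfolding label_sum_def by (intro sum.cong) auto
  then have "label_sum m c (vec m (\<lambda>i. w (c i) / real (card {j \<in> {..<m}. c j = c i}))) v
      = real (card {i \<in> {..<m}. c i = v}) * (w v / real (card {j \<in> {..<m}. c j = v}))"
    by (simp only: sum_constant)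
  ultimately show ?thesis
    using assms by auto
qed

text \<open>The infimum is at most the objective of a vector whose block sums are all optimal;
  quadratic growth in each block then bounds the excess. \<open>W\<close> selects the blocks to
  keep, the others contributing nonnegative terms.\<close>

lemma Delta_label_kernel_ge:
  assumes cvx: "convex_on UNIV (\<lambda>u. loss u y)" and nonneg: "\<And>u. 0 \<le> loss u y" and "0 < lam"
    and a: "a \<in> carrier_vec m" and W: "W \<subseteq> c ` {..<m}"
    and min: "\<And>v. v \<in> W \<Longrightarrow> is_arg_min
      (\<lambda>u. loss u y + lam * real m / (2 * real (card {i \<in> {..<m}. c i = v})) * u\<^sup>2)
          (\<lambda>_. True) (w v)"
  shows "(\<Sum>v\<in>W. lam / 2 * (label_sum m c a v - w v)\<^sup>2)
    \<le> Delta loss m a (label_kernel m c) lam (replicate m y)"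
proof -
  let ?V = "c ` {..<m}"
  let ?n = "\<lambda>v. real (card {i \<in> {..<m}. c i = v})"
  let ?\<mu> = "\<lambda>v. lam * real m / (2 * ?n v)"
  let ?obj = "objective loss m (label_kernel m c) lam (replicate m y)"
  let ?h = "\<lambda>v u. ?n v / real m * loss u y + lam / 2 * u\<^sup>2"
  have pos: "0 < ?n v" "0 < m" if "v \<in> ?V" for v
    using that by (auto simp: card_gt_0_iff)
  have "\<exists>x. is_arg_min (\<lambda>u. loss u y + ?\<mu> v * u\<^sup>2) (\<lambda>_. True) x" if "v \<in> ?V" for v
    using pos[OF that] \<open>0 < lam\<close> by (intro penalised_arg_min_exists cvx nonneg) simp
  then have "\<forall>v\<in>?V. \<exists>x. is_arg_min (\<lambda>u. loss u y + ?\<mu> v * u\<^sup>2) (\<lambda>_. True) x"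
    by blast
  from bchoice[OF this] obtain w' where w':
    "\<And>v. v \<in> ?V \<Longrightarrow> is_arg_min (\<lambda>u. loss u y + ?\<mu> v * u\<^sup>2) (\<lambda>_. True) (w' v)"
    by blast
  define x where "x = (\<lambda>v. if v \<in> W then w v else w' v)"
  have x: "is_arg_min (\<lambda>u. loss u y + ?\<mu> v * u\<^sup>2) (\<lambda>_. True) (x v)" if "v \<in> ?V" for v
    using that min w' by (simp add: x_def)
  have strong: "lam / 2 * (u - x v)\<^sup>2 \<le> ?h v u - ?h v (x v)" if "v \<in> ?V" for u v
  proof -
    have "?\<mu> v * (u - x v)\<^sup>2 \<le> (loss u y + ?\<mu> v * u\<^sup>2) - (loss (x v) y + ?\<mu> v * (x v)\<^sup>2)"
      by (rule penalised_arg_min_strong[OF cvx x[OF that]])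
    then have "?n v / real m * (?\<mu> v * (u - x v)\<^sup>2)
        \<le> ?n v / real m * ((loss u y + ?\<mu> v * u\<^sup>2) - (loss (x v) y + ?\<mu> v * (x v)\<^sup>2))"
      by (intro mult_left_mono) auto
    \<comment> \<open>The weight of a block cancels the block size in its penalty, so the growth
      constant is the same for all blocks.\<close>
    moreover have "?n v / real m * ?\<mu> v = lam / 2"
      using pos[OF that] that by auto
    ultimately show ?thesis
      by (simp only: right_diff_distrib distrib_left mult.assoc[symmetric])
  qed
  define b where "b = vec m (\<lambda>i. x (c i) / real (card {j \<in> {..<m}. c j = c i}))"
  \<comment> \<open>A real \<open>INF\<close> is a lower bound only for sets that are bounded
    below.\<close>
  have "bdd_below (?obj ` carrier_vec m)"
  proof (rule bdd_belowI2)
    fix a' :: "real vec" assume "a' \<in> carrier_vec m"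
    then show "0 \<le> ?obj a'"
      using \<open>0 < lam\<close> nonneg by (simp add: objective_label_kernel sum_nonneg)
  qed
  then have "(INF a\<in>carrier_vec m. ?obj a) \<le> ?obj b"
    by (rule cINF_lower) (simp add: b_def)
  also have "?obj b = (\<Sum>v\<in>?V. ?h v (label_sum m c b v))"
    by (rule objective_label_kernel) (simp add: b_def)
  also have "\<dots> = (\<Sum>v\<in>?V. ?h v (x v))"
    by (intro sum.cong refl) (simp only: b_def label_sum_attains)
  finally have "?obj a - (\<Sum>v\<in>?V. ?h v (x v))
      \<le> Delta loss m a (label_kernel m c) lam (replicate m y)"
    by (simp add: Delta_def)
  moreover have "(\<Sum>v\<in>?V. lam / 2 * (label_sum m c a v - x v)\<^sup>2) \<le> ?obj a - (\<Sum>v\<in>?V. ?h v (x v))"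
    unfolding objective_label_kernel[OF a] sum_subtractf[symmetric]
    by (intro sum_mono strong)
  moreover have "(\<Sum>v\<in>W. lam / 2 * (label_sum m c a v - w v)\<^sup>2)
      \<le> (\<Sum>v\<in>?V. lam / 2 * (label_sum m c a v - x v)\<^sup>2)"
  proof -
    have "(\<Sum>v\<in>W. lam / 2 * (label_sum m c a v - w v)\<^sup>2)
        = (\<Sum>v\<in>W. lam / 2 * (label_sum m c a v - x v)\<^sup>2)"
      by (simp add: x_def)
    then show ?thesis
      using W \<open>0 < lam\<close> by (simp add: sum_mono2)
  qed
  ultimately show ?thesis
    by linarith
qed

text \<open>A convex function on the line is continuous, hence Borel, and the infimum is a constant.
  This allows sums over kernels to be exchanged with the integral over the seed.\<close>

lemma Delta_label_kernel_measurable: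
  assumes cvx: "convex_on UNIV (\<lambda>u. loss u y)"
    and r: "\<And>\<omega>. \<omega> \<in> space M \<Longrightarrow> r \<omega> \<in> carrier_vec m"
    and meas: "\<And>i. i < m \<Longrightarrow> (\<lambda>\<omega>. r \<omega> $ i) \<in> borel_measurable M"
  shows "(\<lambda>\<omega>. Delta loss m (r \<omega>) (label_kernel m c) lam (replicate m y)) \<in> borel_measurable M"
proof -
  have [measurable]: "(\<lambda>u. loss u y) \<in> borel_measurable borel"
    using convex_on_continuous[OF open_UNIV cvx] by (rule borel_measurable_continuous_onI)
  have [measurable]: "(\<lambda>\<omega>. label_sum m c (r \<omega>) v) \<in> borel_measurable M" for v
    unfolding label_sum_def by (intro borel_measurable_sum) (auto intro: meas)
  have "(\<lambda>\<omega>. (\<Sum>v\<in>c ` {..<m}. real (card {i \<in> {..<m}. c i = v}) / real m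
        * loss (label_sum m c (r \<omega>) v) y + lam / 2 * (label_sum m c (r \<omega>) v)\<^sup>2)
      - (INF a\<in>carrier_vec m. objective loss m (label_kernel m c) lam (replicate m y) a))
    \<in> borel_measurable M"
    by measurable
  then show ?thesis
    by (rule measurable_cong[THEN iffD1, rotated])
      (simp add: Delta_def objective_label_kernel r)
qed

section \<open>Hidden matchings\<close>

text \<open>Equal answers along the path actually taken keep both runs on that path.\<close>

lemma returned_queried_cong:
  "(\<And>e. e \<in> queried t K \<Longrightarrow> K $$ e = K' $$ e) \<Longrightarrow>
     returned t K = returned t K' \<and> queried t K = queried t K'"
proof (induction t)
  case (Query i j f)
  have "K $$ (i, j) = K' $$ (i, j)"
    using Query.prems by simp
  then show ?case
    using Query.IH[of "f (K $$ (i, j))"] Query.prems by auto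
qed simp

text \<open>In a pair \<open>(i, j)\<close>, \<open>i\<close> is a left cell and \<open>j\<close> a right cell; \<open>\<sigma>\<close> maps right cells to left cells.\<close>

definition hits :: "(nat \<times> nat) set \<Rightarrow> (nat \<Rightarrow> nat) \<Rightarrow> (nat \<times> nat) set" where
  "hits Q \<sigma> = {x \<in> Q. \<sigma> (snd x) = fst x}"

text \<open>\<open>Q\<close> holds the pairs tested so far and \<open>P\<close> those found matched;
  these are the permutations still possible in that state of a run.\<close>

definition consistent :: "nat \<Rightarrow> (nat \<times> nat) set \<Rightarrow> (nat \<times> nat) set \<Rightarrow> (nat \<Rightarrow> nat) set" where
  "consistent k Q P = {\<sigma>. \<sigma> permutes {..<k} \<and> hits Q \<sigma> = P}"

lemma finite_consistent: "finite (consistent k Q P)"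
  unfolding consistent_def by (rule finite_subset[OF _ finite_permutations[of "{..<k}"]]) auto

text \<open>Swapping the partners of \<open>j\<close> and \<open>l\<close> leads from a \<open>\<sigma>\<close> matching \<open>(i, j)\<close> to another consistent
  permutation, unless one of the three pairs involved has been queried; \<open>(\<sigma>, l)\<close> can be recovered from
  the result. So a query of \<open>(i, j)\<close> rarely hits.\<close>

lemma consistent_switch:
  assumes Q: "finite Q" and j: "j < k" and ij: "(i, j) \<notin> Q"
  shows "real (card {\<sigma> \<in> consistent k Q P. \<sigma> j = i})
      * (real k - real (card P) - real (card {y \<in> Q. fst y = i}) - real (card {y \<in> Q. snd y = j}))
    \<le> real (card (consistent k Q P))"
proof -
  let ?C = "consistent k Q P"
  define C1 where "C1 = {\<sigma> \<in> ?C. \<sigma> j = i}"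
  define V where "V = (\<lambda>\<sigma> :: nat \<Rightarrow> nat.
    {l \<in> {..<k}. (\<sigma> l, l) \<notin> Q \<and> (i, l) \<notin> Q \<and> (\<sigma> l, j) \<notin> Q})"
  let ?r = "real k - real (card P) - real (card {y \<in> Q. fst y = i}) - real (card {y \<in> Q. snd y
      = j})"
  have finC1: "finite C1"
    using finite_consistent by (simp add: C1_def)
  have V_ge: "?r \<le> real (card (V \<sigma>))" if "\<sigma> \<in> C1" for \<sigma>
  proof -
    have perm: "\<sigma> permutes {..<k}" and P: "hits Q \<sigma> = P"
      using that by (auto simp: C1_def consistent_def)
    \<comment> \<open>Each \<open>l\<close> in \<open>X\<close> yields a hit, hence an element of
      \<open>P\<close>; \<open>Y\<close> and \<open>Z\<close> embed into the queried row of
      \<open>i\<close> and column of \<open>j\<close>.\<close>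
    define X where "X = {l \<in> {..<k}. (\<sigma> l, l) \<in> Q}"
    define Y where "Y = {l \<in> {..<k}. (i, l) \<in> Q}"
    define Z where "Z = {l \<in> {..<k}. (\<sigma> l, j) \<in> Q}"
    have "card X \<le> card P"
      using Q P by (intro card_inj_on_le[where f = "\<lambda>l. (\<sigma> l, l)"])
        (auto simp: X_def hits_def inj_on_def)
    moreover have "card Y \<le> card {y \<in> Q. fst y = i}"
      using Q by (intro card_inj_on_le[where f = "\<lambda>l. (i, l)"]) (auto simp: Y_def inj_on_def)
    moreover have "card Z \<le> card {y \<in> Q. snd y = j}"
      using Q permutes_inj[OF perm]
      by (intro card_inj_on_le[where f = "\<lambda>l. (\<sigma> l, j)"]) (auto simp: Z_def inj_on_def)
    moreover have "k \<le> card (V \<sigma>) + card X + card Y + card Z"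
    proof -
      have fin: "finite (V \<sigma>)" "finite X" "finite Y" "finite Z"
        by (auto simp: V_def X_def Y_def Z_def)
      have "{..<k} \<subseteq> V \<sigma> \<union> X \<union> Y \<union> Z"
        by (auto simp: V_def X_def Y_def Z_def)
      then have "k \<le> card (V \<sigma> \<union> X \<union> Y \<union> Z)"
        using fin by (metis card_lessThan card_mono finite_Un)
      also have "\<dots> \<le> card (V \<sigma>) + card X + card Y + card Z"
        by (meson card_Un_le le_trans add_le_mono1)
      finally show ?thesis .
    qed
    ultimately show ?thesis
      by linarith
  qed
  have "card (Sigma C1 V) \<le> card ?C"
  proof (rule card_inj_on_le[where f = "\<lambda>(\<sigma>, l). \<sigma> \<circ> Transposition.transpose j l"])
    show "inj_on (\<lambda>(\<sigma>, l). \<sigma> \<circ> Transposition.transpose j l) (Sigma C1 V)"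
    proof (rule inj_onI, clarify)
      fix \<sigma> l \<sigma>' l'
      assume s: "\<sigma> \<in> C1" "\<sigma>' \<in> C1"
          and eq: "\<sigma> \<circ> Transposition.transpose j l = \<sigma>' \<circ> Transposition.transpose j l'"
      have inj: "inj (\<sigma> \<circ> Transposition.transpose j l)"
        using s by (auto simp: C1_def consistent_def intro!: inj_compose dest: permutes_inj)
      \<comment> \<open>After the swap the value \<open>i\<close> sits at \<open>l\<close>, so
        injectivity recovers \<open>l\<close>.\<close>
      have "(\<sigma> \<circ> Transposition.transpose j l) l = i" "(\<sigma>' \<circ> Transposition.transpose j l') l' = i"
        using s by (auto simp: C1_def)
      then have l: "l = l'"
        using eq inj by (metis injD)
      have "\<sigma> = (\<sigma> \<circ> Transposition.transpose j l) \<circ> Transposition.transpose j l"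
        by (simp add: comp_assoc)
      also have "\<dots> = (\<sigma>' \<circ> Transposition.transpose j l) \<circ> Transposition.transpose j l"
        using eq l by simp
      also have "\<dots> = \<sigma>'"
        by (simp add: comp_assoc)
      finally show "\<sigma> = \<sigma>' \<and> l = l'"
        using l by simp
    qed
    show "(\<lambda>(\<sigma>, l). \<sigma> \<circ> Transposition.transpose j l) ` Sigma C1 V \<subseteq> ?C"
    proof clarify
      fix \<sigma> l
      assume s: "\<sigma> \<in> C1" and l: "l \<in> V \<sigma>"
      have perm: "\<sigma> permutes {..<k}" and P: "hits Q \<sigma> = P" and "\<sigma> j = i"
        using s by (auto simp: C1_def consistent_def)
      have "\<sigma> \<circ> Transposition.transpose j l permutes {..<k}"
        using j l by (intro permutes_compose[OF _ perm] permutes_swap_id) (auto simp: V_def)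
      moreover have "hits Q (\<sigma> \<circ> Transposition.transpose j l) = hits Q \<sigma>"
        using l ij \<open>\<sigma> j = i\<close> by (auto simp: hits_def V_def Transposition.transpose_def)
      ultimately show "\<sigma> \<circ> Transposition.transpose j l \<in> ?C"
        using P by (simp add: consistent_def)
    qed
  qed (rule finite_consistent)
  moreover have "card (Sigma C1 V) = (\<Sum>\<sigma>\<in>C1. card (V \<sigma>))"
    using finC1 by (intro card_SigmaI) (auto simp: V_def)
  moreover have "real (card C1) * ?r \<le> (\<Sum>\<sigma>\<in>C1. real (card (V \<sigma>)))"
    using sum_mono[of C1 "\<lambda>_. ?r", OF V_ge] by simp
  moreover have "(\<Sum>\<sigma>\<in>C1. real (card (V \<sigma>))) = real (\<Sum>\<sigma>\<in>C1. card (V \<sigma>))"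
    by simp
  ultimately have "real (card C1) * ?r \<le> real (card ?C)"
    by linarith
  then show ?thesis
    unfolding C1_def .
qed

section \<open>A potential controlling the number of hits\<close>

definition hit_rows :: "(nat \<times> nat) set \<Rightarrow> (nat \<Rightarrow> nat) \<Rightarrow> (nat \<times> nat) set" where
  "hit_rows Q \<sigma> = {y \<in> Q. \<exists>x\<in>hits Q \<sigma>. fst y = fst x}"

definition hit_columns :: "(nat \<times> nat) set \<Rightarrow> (nat \<Rightarrow> nat) \<Rightarrow> (nat \<times> nat) set" where
  "hit_columns Q \<sigma> = {y \<in> Q. \<exists>x\<in>hits Q \<sigma>. snd y = snd x}"

text \<open>The first term increases by the number of unmatched cells at each hit, and the next two terms
  compensate for the queries in the row and the column of the hit, which the switching bound loses. The
  sum over all consistent permutations therefore does not increase along a run.\<close>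

definition potential :: "nat \<Rightarrow> (nat \<times> nat) set \<Rightarrow> (nat \<Rightarrow> nat) \<Rightarrow> real" where
  "potential k Q \<sigma> = (\<Sum>t<card (hits Q \<sigma>). real k - real t)
     - real (card (hit_rows Q \<sigma>)) - real (card (hit_columns Q \<sigma>)) - real (card Q)"

lemma hits_insert:
  "hits (insert x Q) \<sigma> = (if \<sigma> (snd x) = fst x then insert x (hits Q \<sigma>) else hits Q \<sigma>)"
  by (auto simp: hits_def)

lemma finite_hits: "finite Q \<Longrightarrow> finite (hits Q \<sigma>)"
  by (simp add: hits_def)

lemma potential_insert_miss:
  assumes "finite Q" "x \<notin> Q" "\<sigma> (snd x) \<noteq> fst x"
  shows "potential k (insert x Q) \<sigma> \<le> potential k Q \<sigma> - 1"
proof -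
  have "card (hit_rows Q \<sigma>) \<le> card (hit_rows (insert x Q) \<sigma>)"
    "card (hit_columns Q \<sigma>) \<le> card (hit_columns (insert x Q) \<sigma>)"
    using assms(1) by (auto simp: hit_rows_def hit_columns_def hits_def intro!: card_mono)
  then show ?thesis
    using assms by (simp add: potential_def hits_insert)
qed

text \<open>As \<sigma> is injective, the row and the column of the new hit contain no earlier hit,
  so all their queries are charged for the first time.\<close>

lemma potential_insert_hit:
  assumes fin: "finite Q" and x: "x \<notin> Q" "\<sigma> (snd x) = fst x" and inj: "inj \<sigma>"
  shows "potential k (insert x Q) \<sigma> \<le> potential k Q \<sigma> + (real k - real (card (hits Q \<sigma>))
    - real (card {y \<in> Q. fst y = fst x}) - real (card {y \<in> Q. snd y = snd x})) - 1"
proof -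
  have new: "fst y \<noteq> fst x" "snd y \<noteq> snd x" if "y \<in> hits Q \<sigma>" for y
  proof -
    have y: "y \<noteq> x" "\<sigma> (snd y) = fst y"
      using that x(1) by (auto simp: hits_def)
    have "fst y = fst x \<longleftrightarrow> snd y = snd x"
      using y(2) x(2) inj_eq[OF inj, of "snd y" "snd x"] by simp
    then show "fst y \<noteq> fst x" "snd y \<noteq> snd x"
      using y(1) by (auto simp: prod_eq_iff)
  qed
  have "card (hit_rows Q \<sigma>) + card {y \<in> Q. fst y = fst x}
      = card (hit_rows Q \<sigma> \<union> {y \<in> Q. fst y = fst x})"
    using fin new by (intro card_Un_disjoint[symmetric]) (force simp: hit_rows_def)+
  also have "\<dots> \<le> card (hit_rows (insert x Q) \<sigma>)"
    using fin x by (intro card_mono) (auto simp: hit_rows_def hits_insert)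
  finally have rows: "card (hit_rows Q \<sigma>) + card {y \<in> Q. fst y = fst x}
    \<le> card (hit_rows (insert x Q) \<sigma>)" .
  have "card (hit_columns Q \<sigma>) + card {y \<in> Q. snd y = snd x}
      = card (hit_columns Q \<sigma> \<union> {y \<in> Q. snd y = snd x})"
    using fin new by (intro card_Un_disjoint[symmetric]) (force simp: hit_columns_def)+
  also have "\<dots> \<le> card (hit_columns (insert x Q) \<sigma>)"
    using fin x by (intro card_mono) (auto simp: hit_columns_def hits_insert)
  finally have columns: "card (hit_columns Q \<sigma>) + card {y \<in> Q. snd y = snd x}
    \<le> card (hit_columns (insert x Q) \<sigma>)" .
  have "card (hits (insert x Q) \<sigma>) = Suc (card (hits Q \<sigma>))"
    using fin x by (simp add: hits_insert finite_hits) (simp add: hits_def)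
  then show ?thesis
    using rows columns fin x by (simp add: potential_def)
qed

text \<open>A hit gains at most the factor of the switching bound minus 1, and a miss loses at least
  1. By that bound the factors sum to at most the number of consistent permutations, which the unit
  lost by each of them compensates.\<close>

lemma potential_step:
  assumes Q: "finite Q" and x: "x \<notin> Q" "snd x < k" and "P \<subseteq> Q"
  shows "(\<Sum>\<sigma>\<in>consistent k (insert x Q) (insert x P). potential k (insert x Q) \<sigma>)
      + (\<Sum>\<sigma>\<in>consistent k (insert x Q) P. potential k (insert x Q) \<sigma>)
    \<le> (\<Sum>\<sigma>\<in>consistent k Q P. potential k Q \<sigma>)"
    and "consistent k (insert x Q) (insert x P) \<union> consistent k (insert x Q) P = consistent k Q P"
    and "consistent k (insert x Q) (insert x P) \<inter> consistent k (insert x Q) P = {}"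
proof -
  let ?C = "consistent k Q P"
  let ?Ch = "consistent k (insert x Q) (insert x P)"
  let ?Cm = "consistent k (insert x Q) P"
  let ?r = "real k - real (card P) - real (card {y \<in> Q. fst y = fst x})
    - real (card {y \<in> Q. snd y = snd x})"
  have "x \<notin> P"
    using assms by auto
  have not_hit: "x \<notin> hits Q \<sigma>" for \<sigma>
    using x by (simp add: hits_def)
  have "\<sigma> \<in> ?Ch \<longleftrightarrow> \<sigma> \<in> ?C \<and> \<sigma> (snd x) = fst x" for \<sigma>
  proof (cases "\<sigma> (snd x) = fst x")
    case True
    then show ?thesis
      using insert_ident[OF not_hit[of \<sigma>] \<open>x \<notin> P\<close>] by (simp add: consistent_def hits_insert)
  next
    case False
    then show ?thesis
      using not_hit[of \<sigma>] by (auto simp: consistent_def hits_insert)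
  qed
  then have C1: "?Ch = {\<sigma> \<in> ?C. \<sigma> (snd x) = fst x}"
    by blast
  have C0: "?Cm = {\<sigma> \<in> ?C. \<sigma> (snd x) \<noteq> fst x}"
    using \<open>x \<notin> P\<close> unfolding consistent_def hits_insert by auto
  show un: "?Ch \<union> ?Cm = ?C" and int: "?Ch \<inter> ?Cm = {}"
    unfolding C0 C1 by auto
  have fin: "finite ?Ch" "finite ?Cm"
    by (rule finite_consistent)+
  have "(\<Sum>\<sigma>\<in>?Ch. potential k (insert x Q) \<sigma>) \<le> (\<Sum>\<sigma>\<in>?Ch. potential k Q \<sigma> + (?r - 1))"
  proof (rule sum_mono)
    fix \<sigma> assume "\<sigma> \<in> ?Ch"
    then have "\<sigma> permutes {..<k}" "hits Q \<sigma> = P" "\<sigma> (snd x) = fst x"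
      unfolding C1 by (auto simp: consistent_def)
    then show "potential k (insert x Q) \<sigma> \<le> potential k Q \<sigma> + (?r - 1)"
      using potential_insert_hit[of Q x \<sigma> k] Q x permutes_inj by force
  qed
  moreover have "(\<Sum>\<sigma>\<in>?Cm. potential k (insert x Q) \<sigma>) \<le> (\<Sum>\<sigma>\<in>?Cm. potential k Q \<sigma> - 1)"
    using Q x unfolding C0 by (intro sum_mono potential_insert_miss) auto
  moreover have "(\<Sum>\<sigma>\<in>?C. potential k Q \<sigma>)
      = (\<Sum>\<sigma>\<in>?Ch. potential k Q \<sigma>) + (\<Sum>\<sigma>\<in>?Cm. potential k Q \<sigma>)"
    using sum.union_disjoint[OF fin int] un by simp
  moreover have "real (card ?C) = real (card ?Ch) + real (card ?Cm)"
    using card_Un_disjoint[OF fin int] un by simp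
  moreover have "real (card ?Ch) * ?r \<le> real (card ?C)"
    using consistent_switch[of Q "snd x" k "fst x" P] Q x unfolding C1 by simp
  ultimately show "(\<Sum>\<sigma>\<in>?Ch. potential k (insert x Q) \<sigma>)
      + (\<Sum>\<sigma>\<in>?Cm. potential k (insert x Q) \<sigma>) \<le> (\<Sum>\<sigma>\<in>?C. potential k Q \<sigma>)"
    by (simp add: sum.distrib sum_subtractf right_diff_distrib)
qed

section \<open>Runs of a decision tree\<close>

text \<open>\<open>pr\<close> sends a matrix entry to the pair it tests, or to \<open>None\<close>
  if it tests none. Several entries may test the same pair, which is why pairs are recorded instead
  of entries.\<close>

definition probed ::
    "(nat \<times> nat \<Rightarrow> (nat \<times> nat) option) \<Rightarrow> query_tree \<Rightarrow> real mat \<Rightarrow> (nat \<times> nat) set" where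
  "probed pr t K = {x. \<exists>e\<in>queried t K. pr e = Some x}"

lemma finite_queried: "finite (queried t K)"
  by (induction t) auto

lemma probed_subset: "probed pr t K \<subseteq> (the \<circ> pr) ` queried t K"
  by (force simp: probed_def)

lemma finite_probed: "finite (probed pr t K)"
  using probed_subset finite_queried by (meson finite_imageI finite_subset)

lemma card_probed_le: "card (probed pr t K) \<le> card (queried t K)"
  by (meson card_image_le card_mono finite_imageI finite_queried le_trans probed_subset)

lemma probed_Query:
  "probed pr (Query i j f) K = set_option (pr (i, j)) \<union> probed pr (f (K $$ (i, j))) K"
  by (auto simp: probed_def)

text \<open>Induction over the tree for an arbitrary state \<open>(Q, P)\<close>. Since a value read
  depends on the permutation only through the pair tested, all permutations of one branch continue
  in the same subtree.\<close>

lemma potential_run: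
  assumes pr: "\<And>e x. pr e = Some x \<Longrightarrow> snd x < k"
    and answer: "\<And>\<sigma> \<sigma>' e. \<sigma> permutes {..<k} \<Longrightarrow> \<sigma>' permutes {..<k} \<Longrightarrow> e \<in> E \<Longrightarrow>
      (\<And>x. pr e = Some x \<Longrightarrow> \<sigma> (snd x) = fst x \<longleftrightarrow> \<sigma>' (snd x) = fst x) \<Longrightarrow> K \<sigma> $$ e = K \<sigma>' $$ e"
    and "finite Q" "P \<subseteq> Q" "\<And>\<sigma>. \<sigma> \<in> consistent k Q P \<Longrightarrow> queried t (K \<sigma>) \<subseteq> E"
  shows "(\<Sum>\<sigma>\<in>consistent k Q P. potential k (Q \<union> probed pr t (K \<sigma>)) \<sigma>)
    \<le> (\<Sum>\<sigma>\<in>consistent k Q P. potential k Q \<sigma>)"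
  using assms(3-5)
proof (induction t arbitrary: Q P)
  case (Return a)
  then show ?case
    by (simp add: probed_def)
next
  case (Query i j f)
  \<comment> \<open>\<open>Q'\<close> already contains the pair tested at this node, so the
    permutations consistent with it receive one common answer, and a representative
    \<open>\<sigma>0\<close> names the subtree.\<close>
  have branch: "(\<Sum>\<sigma>\<in>consistent k Q' P'. potential k (Q \<union> probed pr (Query i j f) (K \<sigma>)) \<sigma>)
      \<le> (\<Sum>\<sigma>\<in>consistent k Q' P'. potential k Q' \<sigma>)"
    if Q': "Q' = Q \<union> set_option (pr (i, j))" and P': "P' \<subseteq> Q'"
      and sub: "consistent k Q' P' \<subseteq> consistent k Q P" for Q' P'
  proof (cases "consistent k Q' P' = {}")
    case False
    then obtain \<sigma>0 where \<sigma>0: "\<sigma>0 \<in> consistent k Q' P'"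
      by auto
    have same: "K \<sigma> $$ (i, j) = K \<sigma>0 $$ (i, j)" if "\<sigma> \<in> consistent k Q' P'" for \<sigma>
    proof (rule answer)
      show "\<sigma> permutes {..<k}" "\<sigma>0 permutes {..<k}"
        using that \<sigma>0 by (auto simp: consistent_def)
      show "(i, j) \<in> E"
        using Query.prems(3)[of \<sigma>0] \<sigma>0 sub by auto
      fix x assume "pr (i, j) = Some x"
      then have "x \<in> Q'"
        using Q' by simp
      moreover have "hits Q' \<sigma> = hits Q' \<sigma>0"
        using that \<sigma>0 by (auto simp: consistent_def)
      ultimately show "\<sigma> (snd x) = fst x \<longleftrightarrow> \<sigma>0 (snd x) = fst x"
        by (auto simp: hits_def)
    qed
    let ?t = "f (K \<sigma>0 $$ (i, j))"
    have "(\<Sum>\<sigma>\<in>consistent k Q' P'. potential k (Q' \<union> probed pr ?t (K \<sigma>)) \<sigma>)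
        \<le> (\<Sum>\<sigma>\<in>consistent k Q' P'. potential k Q' \<sigma>)"
    proof (rule Query.IH)
      show "finite Q'"
        using Query.prems(1) Q' by simp
      show "queried ?t (K \<sigma>) \<subseteq> E" if "\<sigma> \<in> consistent k Q' P'" for \<sigma>
        using Query.prems(3)[of \<sigma>] same[OF that] that sub by auto
    qed (use P' in auto)
    moreover have "Q \<union> probed pr (Query i j f) (K \<sigma>) = Q' \<union> probed pr ?t (K \<sigma>)"
      if "\<sigma> \<in> consistent k Q' P'" for \<sigma>
      using same[OF that] by (simp add: probed_Query Q' Un_assoc)
    ultimately show ?thesis
      by simp
  qed simp
  show ?case
  \<comment> \<open>An entry that tests no new pair leaves the state unchanged, and there is a
    single branch.\<close>
  proof (cases "set_option (pr (i, j)) \<subseteq> Q")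
    case True
    then show ?thesis
      using branch[of Q P] Query.prems by (simp add: Un_absorb2)
  next
    case False
    then obtain x where x: "pr (i, j) = Some x" "x \<notin> Q"
      by auto
    note step = potential_step[OF Query.prems(1) x(2) pr[OF x(1)] Query.prems(2)]
    let ?Ch = "consistent k (insert x Q) (insert x P)"
    let ?Cm = "consistent k (insert x Q) P"
    let ?p = "\<lambda>\<sigma>. potential k (Q \<union> probed pr (Query i j f) (K \<sigma>)) \<sigma>"
    have "(\<Sum>\<sigma>\<in>consistent k Q P. ?p \<sigma>) = (\<Sum>\<sigma>\<in>?Ch. ?p \<sigma>) + (\<Sum>\<sigma>\<in>?Cm. ?p \<sigma>)"
      unfolding step(2)[symmetric]
      by (rule sum.union_disjoint[OF finite_consistent finite_consistent step(3)])
    also have "\<dots> \<le> (\<Sum>\<sigma>\<in>?Ch. potential k (insert x Q) \<sigma>) + (\<Sum>\<sigma>\<in>?Cm. potential k (insert x Q) \<sigma>)"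
      using step(2) Query.prems(2) x(1) by (intro add_mono branch) auto
    also have "\<dots> \<le> (\<Sum>\<sigma>\<in>consistent k Q P. potential k Q \<sigma>)"
      by (rule step(1))
    finally show ?thesis .
  qed
qed

lemma card_hits_le:
  assumes "\<sigma> permutes {..<k}" "finite Q" "snd ` Q \<subseteq> {..<k}"
  shows "card (hits Q \<sigma>) \<le> k"
proof -
  have "inj_on snd (hits Q \<sigma>)"
    by (auto simp: inj_on_def hits_def prod_eq_iff)
  then show ?thesis
    using assms(3) card_inj_on_le[of snd "hits Q \<sigma>" "{..<k}"] by (force simp: hits_def)
qed

text \<open>With \<open>h\<close> hits the first term is \<open>h * k - h * (h - 1) / 2\<close>, at
  least half of \<open>h * k\<close> because \<open>h \<le> k\<close>; each subtracted cardinality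
  is at most \<open>card Q\<close>.\<close>

lemma potential_ge:
  assumes "finite Q" "card (hits Q \<sigma>) \<le> k"
  shows "real (card (hits Q \<sigma>)) * real k / 2 - 3 * real (card Q) \<le> potential k Q \<sigma>"
proof -
  have "(\<Sum>t<h. real k - real t) = real h * real k - real h * (real h - 1) / 2" for h
    by (induction h) (auto simp: field_simps)
  moreover have "real (card (hits Q \<sigma>)) * (real (card (hits Q \<sigma>)) - 1)
      \<le> real (card (hits Q \<sigma>)) * real k"
    using assms(2) by (intro mult_left_mono) auto
  ultimately have "real (card (hits Q \<sigma>)) * real k / 2 \<le> (\<Sum>t<card (hits Q \<sigma>). real k - real t)"
    by (simp add: mult.commute)
  moreover have "card (hit_rows Q \<sigma>) \<le> card Q" "card (hit_columns Q \<sigma>) \<le> card Q"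
    using assms(1) by (auto simp: hit_rows_def hit_columns_def intro!: card_mono)
  ultimately show ?thesis
    by (simp add: potential_def)
qed

text \<open>The potential is 0 before the first query and its sum never increases, so its lower
  bound per permutation limits the hits on average, to \<open>6 * B / k\<close> for a uniformly
  random matching.\<close>

lemma expected_hits_le:
  assumes pr: "\<And>e x. pr e = Some x \<Longrightarrow> snd x < k"
    and answer: "\<And>\<sigma> \<sigma>' e. \<sigma> permutes {..<k} \<Longrightarrow> \<sigma>' permutes {..<k} \<Longrightarrow> e \<in> E \<Longrightarrow>
      (\<And>x. pr e = Some x \<Longrightarrow> \<sigma> (snd x) = fst x \<longleftrightarrow> \<sigma>' (snd x) = fst x) \<Longrightarrow> K \<sigma> $$ e = K \<sigma>' $$ e"
    and E: "\<And>\<sigma>. \<sigma> permutes {..<k} \<Longrightarrow> queried t (K \<sigma>) \<subseteq> E"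
    and B: "\<And>\<sigma>. \<sigma> permutes {..<k} \<Longrightarrow> card (queried t (K \<sigma>)) \<le> B"
  shows "(\<Sum>\<sigma> | \<sigma> permutes {..<k}. real (card (hits (probed pr t (K \<sigma>)) \<sigma>))) * real k
    \<le> 6 * real B * fact k"
proof -
  let ?S = "{\<sigma>. \<sigma> permutes {..<k}}"
  let ?h = "\<lambda>\<sigma>. real (card (hits (probed pr t (K \<sigma>)) \<sigma>))"
  have S: "consistent k {} {} = ?S"
    by (auto simp: consistent_def hits_def)
  have "(\<Sum>\<sigma>\<in>?S. ?h \<sigma> * real k / 2 - 3 * real B) \<le> (\<Sum>\<sigma>\<in>?S. potential k (probed pr t (K \<sigma>)) \<sigma>)"
  proof (rule sum_mono)
    fix \<sigma> assume s: "\<sigma> \<in> ?S"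
    have "snd ` probed pr t (K \<sigma>) \<subseteq> {..<k}"
      using pr by (auto simp: probed_def)
    then have "card (hits (probed pr t (K \<sigma>)) \<sigma>) \<le> k"
      using s by (intro card_hits_le finite_probed) auto
    moreover have "card (probed pr t (K \<sigma>)) \<le> B"
      using B[of \<sigma>] s card_probed_le[of pr t "K \<sigma>"] by simp
    ultimately show "?h \<sigma> * real k / 2 - 3 * real B \<le> potential k (probed pr t (K \<sigma>)) \<sigma>"
      using potential_ge[OF finite_probed, of pr t "K \<sigma>" \<sigma> k] by simp
  qed
  also have "\<dots> \<le> (\<Sum>\<sigma>\<in>?S. potential k {} \<sigma>)"
  proof -
    have "(\<Sum>\<sigma>\<in>consistent k {} {}. potential k ({} \<union> probed pr t (K \<sigma>)) \<sigma>)
        \<le> (\<Sum>\<sigma>\<in>consistent k {} {}. potential k {} \<sigma>)"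
    proof (rule potential_run[where E = E])
      show "snd x < k" if "pr e = Some x" for e x
        using pr that .
      show "K \<sigma> $$ e = K \<sigma>' $$ e"
        if "\<sigma> permutes {..<k}" "\<sigma>' permutes {..<k}" "e \<in> E"
          "\<And>x. pr e = Some x \<Longrightarrow> \<sigma> (snd x) = fst x \<longleftrightarrow> \<sigma>' (snd x) = fst x" for \<sigma> \<sigma>' e
        using answer that .
    qed (use E in \<open>auto simp: consistent_def\<close>)
    then show ?thesis
      by (simp add: S)
  qed
  also have "\<dots> = 0"
    by (simp add: potential_def hits_def hit_rows_def hit_columns_def)
  finally have "(\<Sum>\<sigma>\<in>?S. ?h \<sigma>) * real k / 2 - 3 * real B * real (card ?S) \<le> 0"
    by (simp add: sum_subtractf sum_divide_distrib[symmetric]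
        sum_distrib_left[symmetric] mult.commute)
  moreover have "card ?S = fact k"
    using card_permutations[of "{..<k}" k] by simp
  ultimately show ?thesis
    by simp
qed

section \<open>The hard kernels\<close>

text \<open>Cell \<open>q\<close> consists of the \<open>n\<close> points \<open>a\<close> with \<open>a div n = q\<close>. Cells below \<open>k\<close> are left cells, the next
  \<open>k\<close> are right cells, and all other points share the label \<open>2 * k\<close>. The right cell \<open>k + j\<close> is the
  partner of the left cell \<open>\<sigma> j\<close>, and \<open>T\<close> is the set of left cells merged with their partners.\<close>

definition cell_label :: "nat \<Rightarrow> nat \<Rightarrow> (nat \<Rightarrow> nat) \<Rightarrow> nat set \<Rightarrow> nat \<Rightarrow> nat" where
  "cell_label k n \<sigma> T a =
     (if a div n < k then a div n
      else if a div n < 2 * k then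
        (if \<sigma> (a div n - k) \<in> T then \<sigma> (a div n - k) else k + \<sigma> (a div n - k))
      else 2 * k)"

text \<open>Only entries between a left and a right cell, in either order as the kernel is
  symmetric, can depend on the matching. Right cells are counted from 0 to serve as arguments of
  \<sigma>.\<close>

definition cell_pair :: "nat \<Rightarrow> nat \<Rightarrow> nat \<times> nat \<Rightarrow> (nat \<times> nat) option" where
  "cell_pair k n e =
     (if fst e div n < k \<and> k \<le> snd e div n \<and> snd e div n < 2 * k
      then Some (fst e div n, snd e div n - k)
      else if snd e div n < k \<and> k \<le> fst e div n \<and> fst e div n < 2 * k
      then Some (snd e div n, fst e div n - k)
      else None)"

definition cell :: "nat \<Rightarrow> nat \<Rightarrow> nat set" where
  "cell n q = {q * n..<q * n + n}"

lemma cell_pair_bounds: "cell_pair k n e = Some x \<Longrightarrow> fst x < k \<and> snd x < k"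
  by (auto simp: cell_pair_def split: if_splits)

text \<open>This says what a query can reveal: \<open>T\<close> shows only in entries between
  matched cells, and a 0 there looks the same as between unmatched cells.\<close>

lemma cell_label_eq_iff:
  assumes "\<sigma> permutes {..<k}"
  shows "cell_label k n \<sigma> T a = cell_label k n \<sigma> T b \<longleftrightarrow>
    a div n = b div n \<or> (2 * k \<le> a div n \<and> 2 * k \<le> b div n) \<or>
    (\<exists>x. cell_pair k n (a, b) = Some x \<and> \<sigma> (snd x) = fst x \<and> fst x \<in> T)"
proof -
  have lt: "\<sigma> j < k" if "j < k" for j
    using permutes_in_image[OF assms, of j] that by simp
  have inj: "\<sigma> i = \<sigma> j \<longleftrightarrow> i = j" for i j
    using permutes_inj[OF assms] by (rule inj_eq)
  define p where "p = a div n"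
  define q where "q = b div n"
  have p: "\<sigma> (p - k) < k" if "\<not> p < k" "p < 2 * k"
    using that by (intro lt) auto
  have q: "\<sigma> (q - k) < k" if "\<not> q < k" "q < 2 * k"
    using that by (intro lt) auto
  have "p - k = q - k \<longleftrightarrow> p = q" if "\<not> p < k" "\<not> q < k"
    using that by auto
  then show ?thesis
    unfolding cell_label_def cell_pair_def fst_conv snd_conv p_def[symmetric] q_def[symmetric]
    using p q by (cases "p < k"; cases "p < 2 * k"; cases "q < k"; cases "q < 2 * k")
        (auto simp: inj)
qed

text \<open>For \<open>k = d - 1\<close> the bound is \<open>2 * d - 1\<close>, within the
  \<open>2 * d\<close> blocks allowed; \<open>k = d\<close> would exceed them.\<close>

lemma card_cell_label_le:
  assumes "\<sigma> permutes {..<k}"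
  shows "card (cell_label k n \<sigma> T ` {..<m}) \<le> 2 * k + 1"
proof -
  have "\<sigma> j < k" if "j < k" for j
    using permutes_in_image[OF assms, of j] that by simp
  moreover have "a div n - k < k" if "a div n < 2 * k" "\<not> a div n < k" for a
    using that by auto
  ultimately have "cell_label k n \<sigma> T ` {..<m} \<subseteq> {..2 * k}"
    by (fastforce simp: cell_label_def)
  then have "card (cell_label k n \<sigma> T ` {..<m}) \<le> card {..2 * k}"
    by (intro card_mono) auto
  then show ?thesis
    by simp
qed

lemma mem_cell_iff: "0 < n \<Longrightarrow> a \<in> cell n q \<longleftrightarrow> a div n = q"
proof
  show "a div n = q" if "a \<in> cell n q"
    using that by (auto simp: cell_def mult.commute intro!: div_nat_eqI)
  show "a \<in> cell n q" if "0 < n" "a div n = q"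
    using that dividend_less_div_times[of n a] by (auto simp: cell_def add.commute)
qed

lemma card_cell: "card (cell n q) = n"
  by (simp add: cell_def)

text \<open>The label of a split right cell is formed from its left partner, so both fibres of a
  pair are indexed by \<open>g\<close>; the right partner is \<open>inv \<sigma> g\<close>.\<close>

lemma cell_label_fibers:
  assumes perm: "\<sigma> permutes {..<k}" and "0 < n" and m: "2 * k * n \<le> m" and g: "g < k"
  shows "g \<in> T \<Longrightarrow> {i \<in> {..<m}. cell_label k n \<sigma> T i = g}
      = cell n g \<union> cell n (k + Hilbert_Choice.inv \<sigma> g)"
    and "g \<notin> T \<Longrightarrow> {i \<in> {..<m}. cell_label k n \<sigma> T i = g} = cell n g"
    and "g \<notin> T \<Longrightarrow> {i \<in> {..<m}. cell_label k n \<sigma> T i = k + g} = cell n (k + Hilbert_Choice.inv \<sigma> g)"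
proof -
  have lt: "\<sigma> j < k \<longleftrightarrow> j < k" for j
    using permutes_in_image[OF perm, of j] by simp
  have inv: "Hilbert_Choice.inv \<sigma> g = j \<longleftrightarrow> \<sigma> j = g" for j
    using permutes_inv_eq[OF perm] .
  then have inv_lt: "Hilbert_Choice.inv \<sigma> g < k"
    using lt g by metis
  \<comment> \<open>All \<open>2 * k\<close> cells lie entirely below \<open>m\<close>, so no fibre
    is truncated.\<close>
  have im: "i < m" if "i div n < 2 * k" for i
    using that m \<open>0 < n\<close> by (simp add: div_less_iff_less_mult)
  have right: "i div n = k + Hilbert_Choice.inv \<sigma> g \<longleftrightarrow> k
      \<le> i div n \<and> i div n < 2 * k \<and> \<sigma> (i div n - k) = g" for i
  proof
    show "k \<le> i div n \<and> i div n < 2 * k \<and> \<sigma> (i div n - k) = g"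
        if "i div n = k + Hilbert_Choice.inv \<sigma> g"
      using that inv inv_lt by auto
    show "i div n = k + Hilbert_Choice.inv \<sigma> g"
        if "k \<le> i div n \<and> i div n < 2 * k \<and> \<sigma> (i div n - k) = g"
      using that inv[of "i div n - k"] by auto
  qed
  have \<sigma>: "\<sigma> (i div n - k) < k" if "\<not> i div n < k" "i div n < 2 * k" for i
    using that by (auto simp: lt)
  note simps = mem_cell_iff[OF \<open>0 < n\<close>] right cell_label_def
  have "i \<in> {i \<in> {..<m}. cell_label k n \<sigma> T i = g}
      \<longleftrightarrow> i \<in> cell n g \<union> cell n (k + Hilbert_Choice.inv \<sigma> g)"
    if "g \<in> T" for i
    using that g im[of i] \<sigma>[of i] by (auto simp: simps)
  then show "g \<in> T \<Longrightarrow> {i \<in> {..<m}. cell_label k n \<sigma> T i = g}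
      = cell n g \<union> cell n (k + Hilbert_Choice.inv \<sigma> g)"
    by blast
  have "i \<in> {i \<in> {..<m}. cell_label k n \<sigma> T i = g} \<longleftrightarrow> i \<in> cell n g" if "g \<notin> T" for i
    using that g im[of i] \<sigma>[of i] by (auto simp: simps)
  then show "g \<notin> T \<Longrightarrow> {i \<in> {..<m}. cell_label k n \<sigma> T i = g} = cell n g"
    by blast
  have "i \<in> {i \<in> {..<m}. cell_label k n \<sigma> T i = k + g} \<longleftrightarrow> i \<in> cell n (k + Hilbert_Choice.inv \<sigma> g)"
    if "g \<notin> T" for i
    using that g im[of i] \<sigma>[of i] by (auto simp: simps)
  then show "g \<notin> T \<Longrightarrow> {i \<in> {..<m}. cell_label k n \<sigma> T i = k + g}
      = cell n (k + Hilbert_Choice.inv \<sigma> g)"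
    by blast
qed

section \<open>Excess caused by a matched pair\<close>

lemma u1_arg_min:
  assumes "convex_on UNIV (\<lambda>u. loss u y)" "\<And>u. 0 \<le> loss u y" "0 < p * lam * real d"
  shows "is_arg_min (\<lambda>u. loss u y + p * lam * real d * u\<^sup>2) (\<lambda>_. True) (u1 loss lam d p y)"
  unfolding u1_def arg_min_def by (rule someI_ex) (rule penalised_arg_min_exists[OF assms])

lemma u2_arg_min:
  assumes "convex_on UNIV (\<lambda>u. loss u y)" "\<And>u. 0 \<le> loss u y" "0 < p * lam * real d"
  shows "is_arg_min (\<lambda>u. loss u y + p * lam * real d / 2 * u\<^sup>2) (\<lambda>_. True) (u2 loss lam d p y)"
  unfolding u2_def arg_min_def
  by (rule someI_ex) (rule penalised_arg_min_exists[OF assms(1,2)], use assms(3) in simp)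

text \<open>The cell sums \<open>L\<close> and \<open>R\<close> do not involve \<open>T\<close>, so
  the merged and the split case can be compared for one coefficient vector.\<close>

definition group_excess ::
    "real \<Rightarrow> nat \<Rightarrow> nat \<Rightarrow> real \<Rightarrow> real \<Rightarrow> (nat \<Rightarrow> nat) \<Rightarrow> real vec \<Rightarrow> nat set \<Rightarrow> nat \<Rightarrow> real" where
  "group_excess lam k n v1 v2 \<sigma> a T g =
     (let L = (\<Sum>i\<in>cell n g. a $ i); R = (\<Sum>i\<in>cell n (k + Hilbert_Choice.inv \<sigma> g). a $ i)
      in if g \<in> T then lam / 2 * (L + R - v2)\<^sup>2
         else lam / 2 * (L - v1)\<^sup>2 + lam / 2 * (R - v1)\<^sup>2)"

text \<open>This \<open>p\<close> makes the effective penalty of a block of size \<open>n\<close>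
  that of \<open>u1\<close>, and the penalty of a block of size \<open>2 * n\<close> that of
  \<open>u2\<close>.\<close>

lemma Delta_cell_label_ge:
  assumes cvx: "convex_on UNIV (\<lambda>u. loss u y)" and nonneg: "\<And>u. 0 \<le> loss u y" and "0 < lam"
    and "0 < d" "0 < n" "2 * k * n \<le> m" "0 < m" and p: "p = real m / (2 * real n * real d)"
    and perm: "\<sigma> permutes {..<k}" and T: "T \<subseteq> {..<k}" and a: "a \<in> carrier_vec m"
  shows "(\<Sum>g<k. group_excess lam k n (u1 loss lam d p y) (u2 loss lam d p y) \<sigma> a T g)
    \<le> Delta loss m a (label_kernel m (cell_label k n \<sigma> T)) lam (replicate m y)"
proof -
  let ?c = "cell_label k n \<sigma> T"
  let ?u1 = "u1 loss lam d p y" and ?u2 = "u2 loss lam d p y"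
  define w where "w = (\<lambda>v. if v \<in> T then ?u2 else ?u1)"
  \<comment> \<open>A pair always uses the label of its left cell, and the shifted label only if it
    is split. The remainder, labelled \<open>2 * k\<close>, is left out.\<close>
  define W where "W = {..<k} \<union> (+) k ` ({..<k} - T)"
  note fibers = cell_label_fibers[OF perm \<open>0 < n\<close> \<open>2 * k * n \<le> m\<close>]
  have pos: "0 < p * lam * real d"
    using assms by simp
  have half: "lam * real m / (2 * real n) = p * lam * real d"
    using p \<open>0 < d\<close> \<open>0 < n\<close> by simp
  have full: "lam * real m / (2 * real (n + n)) = p * lam * real d / 2"
    using p \<open>0 < d\<close> \<open>0 < n\<close> by simp
  have min1: "is_arg_min (\<lambda>u. loss u y + lam * real m / (2 * real n) * u\<^sup>2) (\<lambda>_. True) ?u1"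
    unfolding half by (rule u1_arg_min[where loss = loss and y = y, OF cvx nonneg pos])
  have min2: "is_arg_min (\<lambda>u. loss u y + lam * real m / (2 * real (n + n)) * u\<^sup>2) (\<lambda>_. True) ?u2"
    unfolding full by (rule u2_arg_min[where loss = loss and y = y, OF cvx nonneg pos])
  have disj: "cell n g \<inter> cell n (k + Hilbert_Choice.inv \<sigma> g) = {}" if "g < k" for g
    using that \<open>0 < n\<close> by (auto simp: mem_cell_iff)
  have fin: "finite (cell n q)" for q
    by (simp add: cell_def)
  have card: "card {i \<in> {..<m}. ?c i = v} = (if v \<in> T then n + n else n)" if "v \<in> W" for v
    using that T fibers disj fin
    by (auto simp: W_def card_cell card_Un_disjoint simp del: Collect_conj_eq)
  have "(\<Sum>v\<in>W. lam / 2 * (label_sum m ?c a v - w v)\<^sup>2)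
      \<le> Delta loss m a (label_kernel m ?c) lam (replicate m y)"
  proof (rule Delta_label_kernel_ge[where loss = loss and y = y, OF cvx nonneg \<open>0 < lam\<close> a])
    show "W \<subseteq> ?c ` {..<m}"
    proof
      fix v assume "v \<in> W"
      then have "card {i \<in> {..<m}. ?c i = v} \<noteq> 0"
        using card[of v] \<open>0 < n\<close> by simp
      then have "{i \<in> {..<m}. ?c i = v} \<noteq> {}"
        by (metis card.empty)
      then show "v \<in> ?c ` {..<m}"
        by auto
    qed
    fix v assume "v \<in> W"
    show "is_arg_min (\<lambda>u. loss u y + lam * real m / (2 * real (card {i \<in> {..<m}. ?c i = v})) * u\<^sup>2)
        (\<lambda>_. True) (w v)"
      unfolding card[OF \<open>v \<in> W\<close>] w_def
      by (cases "v \<in> T") (simp_all only: if_True if_False min1 min2)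
  qed
  moreover have "(\<Sum>v\<in>W. lam / 2 * (label_sum m ?c a v - w v)\<^sup>2)
      = (\<Sum>g<k. group_excess lam k n ?u1 ?u2 \<sigma> a T g)"
  proof -
    let ?f = "\<lambda>v. lam / 2 * (label_sum m ?c a v - w v)\<^sup>2"
    have "(\<Sum>v\<in>W. ?f v) = (\<Sum>g<k. ?f g) + (\<Sum>g\<in>{..<k} - T. ?f (k + g))"
      unfolding W_def by (subst sum.union_disjoint) (auto simp: sum.reindex)
    also have "(\<Sum>g\<in>{..<k} - T. ?f (k + g)) = (\<Sum>g<k. if g \<in> T then 0 else ?f (k + g))"
      by (simp add: sum.If_cases Diff_eq)
    also have "(\<Sum>g<k. ?f g) + \<dots> = (\<Sum>g<k. group_excess lam k n ?u1 ?u2 \<sigma> a T g)"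
      unfolding sum.distrib[symmetric]
    proof (rule sum.cong[OF refl])
      fix g assume "g \<in> {..<k}"
      then have g: "g < k" "k + g \<notin> T"
        using T by auto
      show "?f g + (if g \<in> T then 0 else ?f (k + g)) = group_excess lam k n ?u1 ?u2 \<sigma> a T g"
        unfolding label_sum_def group_excess_def Let_def w_def
        using g by (cases "g \<in> T") (simp_all only: fibers if_True if_False
          sum.union_disjoint[OF fin fin disj[OF g(1)]] add_0_right simp_thms)
    qed
    finally show ?thesis .
  qed
  ultimately show ?thesis
    by simp
qed

lemma group_excess_nonneg: "0 < lam \<Longrightarrow> 0 \<le> group_excess lam k n v1 v2 \<sigma> a T g"
  by (simp add: group_excess_def Let_def)

text \<open>Cauchy-Schwarz, since \<open>2 * v1 - v2\<close> equals
  \<open>(x + y - v2) - (x - v1) - (y - v1)\<close>.\<close>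

lemma sum_three_squares_ge: "(2 * v1 - v2)\<^sup>2 / 3 \<le> (x + y - v2)\<^sup>2 + (x - v1)\<^sup>2 + (y - v1)\<^sup>2"
  for v1 v2 x y :: real
proof -
  \<comment> \<open>These squares are exactly the defect in the Cauchy-Schwarz inequality.\<close>
  have "0 \<le> (v2 - (x + y) - (x - v1))\<^sup>2 + (v2 - (x + y) - (y - v1))\<^sup>2 + ((x - v1) - (y - v1))\<^sup>2"
    by simp
  then have "(2 * v1 - v2)\<^sup>2 \<le> 3 * ((x + y - v2)\<^sup>2 + (x - v1)\<^sup>2 + (y - v1)\<^sup>2)"
    by (simp add: power2_eq_square algebra_simps)
  then show ?thesis
    by simp
qed

definition flip :: "nat \<Rightarrow> nat set \<Rightarrow> nat set" where
  "flip g T = (if g \<in> T then T - {g} else insert g T)"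

lemma group_excess_flip:
  assumes "0 < lam"
  shows "lam / 6 * (2 * v1 - v2)\<^sup>2
    \<le> group_excess lam k n v1 v2 \<sigma> a T g + group_excess lam k n v1 v2 \<sigma> a (flip g T) g"
proof -
  let ?L = "\<Sum>i\<in>cell n g. a $ i" and ?R = "\<Sum>i\<in>cell n (k + Hilbert_Choice.inv \<sigma> g). a $ i"
  have "lam / 2 * ((2 * v1 - v2)\<^sup>2 / 3)
      \<le> lam / 2 * ((?L + ?R - v2)\<^sup>2 + (?L - v1)\<^sup>2 + (?R - v1)\<^sup>2)"
    using assms by (intro mult_left_mono sum_three_squares_ge) simp
  then show ?thesis
    by (cases "g \<in> T") (simp_all add: group_excess_def flip_def Let_def distrib_left)
qed

text \<open>As \<open>flip g\<close> permutes \<open>N\<close>, summing the last hypothesis over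
  \<open>N\<close> counts every \<open>D T\<close> twice. In the application \<open>N\<close>
  collects the \<open>T\<close> for which a run leaves pair \<open>g\<close> undetected.\<close>

lemma sum_flip_ge:
  fixes D :: "nat set \<Rightarrow> real"
  assumes "finite S" "N \<subseteq> Pow S" and nonneg: "\<And>T. 0 \<le> D T"
    and flip: "\<And>T. T \<in> N \<Longrightarrow> flip g T \<in> N" "\<And>T. T \<in> N \<Longrightarrow> c \<le> D T + D (flip g T)"
  shows "c / 2 * real (card N) \<le> (\<Sum>T\<in>Pow S. D T)"
proof -
  have "flip g (flip g T) = T" for T
    by (auto simp: flip_def)
  then have "(\<Sum>T\<in>N. D (flip g T)) = (\<Sum>T\<in>N. D T)"
    using flip(1) by (intro sum.reindex_bij_witness[of N "flip g" "flip g"]) auto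
  moreover have "real (card N) * c \<le> (\<Sum>T\<in>N. D T + D (flip g T))"
    using sum_mono[of N "\<lambda>_. c", OF flip(2)] by simp
  moreover have "(\<Sum>T\<in>N. D T) \<le> (\<Sum>T\<in>Pow S. D T)"
    using assms by (intro sum_mono2) auto
  ultimately show ?thesis
    by (simp add: sum.distrib mult.commute)
qed

section \<open>Averaging over the hard kernels\<close>

lemma cell_label_kernel_index:
  assumes "\<sigma> permutes {..<k}" "a < m" "b < m"
  shows "label_kernel m (cell_label k n \<sigma> T) $$ (a, b) =
    (if a div n = b div n \<or> (2 * k \<le> a div n \<and> 2 * k \<le> b div n) \<or>
        (\<exists>x. cell_pair k n (a, b) = Some x \<and> \<sigma> (snd x) = fst x \<and> fst x \<in> T) then 1 else 0)"
  using assms by (simp add: label_kernel_def cell_label_eq_iff)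

text \<open>For fixed \<sigma>, flipping an undetected pair does not change the output, so the two
  kernels together cost \<open>lam / 6\<close> times the gap at that pair, half of it each on
  average. For fixed \<open>T\<close>, hits are rare for an average \<sigma>.\<close>

lemma sum_Delta_cell_label_ge:
  fixes t :: query_tree and k n m d B :: nat
  defines "K \<equiv> \<lambda>\<sigma> T. label_kernel m (cell_label k n \<sigma> T)"
  assumes cvx: "convex_on UNIV (\<lambda>u. loss u y)" and nonneg: "\<And>u. 0 \<le> loss u y" and "0 < lam"
    and "0 < d" "0 < n" "2 * k * n \<le> m" "0 < m" and p: "p = real m / (2 * real n * real d)"
    and "0 < k"
    and t: "\<And>\<sigma> T. \<sigma> permutes {..<k} \<Longrightarrow> queried t (K \<sigma> T) \<subseteq> {..<m} \<times> {..<m}"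
      "\<And>\<sigma> T. \<sigma> permutes {..<k} \<Longrightarrow> card (queried t (K \<sigma> T)) \<le> B"
      "\<And>\<sigma> T. \<sigma> permutes {..<k} \<Longrightarrow> returned t (K \<sigma> T) \<in> carrier_vec m"
  shows "lam / 12 * gap loss lam d p y * (2 ^ k * fact k * (real k - 6 * real B / real k))
    \<le> (\<Sum>\<sigma> | \<sigma> permutes {..<k}. \<Sum>T\<in>Pow {..<k}.
          Delta loss m (returned t (K \<sigma> T)) (K \<sigma> T) lam (replicate m y))"
proof -
  let ?S = "{\<sigma>. \<sigma> permutes {..<k}}" and ?P = "Pow {..<k}"
  let ?ex = "\<lambda>\<sigma> T g. group_excess lam k n (u1 loss lam d p y) (u2 loss lam d p y) \<sigma>
    (returned t (K \<sigma> T)) T g"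
  define c where "c = lam / 6 * gap loss lam d p y"
  define H where "H = (\<lambda>\<sigma> T. hits (probed (cell_pair k n) t (K \<sigma> T)) \<sigma>)"
  have finS: "finite ?S" and cardS: "card ?S = fact k"
    using finite_permutations[of "{..<k}"] card_permutations[of "{..<k}" k] by auto
  have "0 \<le> c"
    using \<open>0 < lam\<close> by (simp add: c_def gap_def)
  \<comment> \<open>The flip alters only entries between cell \<open>g\<close> and its partner, and
    without a hit at \<open>g\<close> none of them is read. Invariance of \<open>H\<close> keeps the
    family of undetected \<open>T\<close> closed under the flip.\<close>
  have unhit: "returned t (K \<sigma> (flip g T)) = returned t (K \<sigma> T) \<and> H \<sigma> (flip g T) = H \<sigma> T"
    if perm: "\<sigma> permutes {..<k}" and g: "g \<notin> fst ` H \<sigma> T" for \<sigma> T g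
  proof -
    have "K \<sigma> T $$ e = K \<sigma> (flip g T) $$ e" if e: "e \<in> queried t (K \<sigma> T)" for e
    proof -
      obtain a b where ab: "e = (a, b)" "a < m" "b < m"
        using t(1)[OF perm, of T] e by auto
      have "fst x \<in> T \<longleftrightarrow> fst x \<in> flip g T"
        if "cell_pair k n (a, b) = Some x" "\<sigma> (snd x) = fst x" for x
      proof -
        have "x \<in> H \<sigma> T"
          using that e ab(1) by (auto simp: H_def hits_def probed_def)
        then show ?thesis
          using g by (auto simp: flip_def)
      qed
      then show ?thesis
        unfolding K_def ab(1) cell_label_kernel_index[OF perm ab(2,3)]
        by (intro if_cong refl) blast
    qed
    then have "returned t (K \<sigma> T) = returned t (K \<sigma> (flip g T))
        \<and> queried t (K \<sigma> T) = queried t (K \<sigma> (flip g T))"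
      by (rule returned_queried_cong)
    then show ?thesis
      by (simp add: H_def probed_def)
  qed
  have per_perm: "c / 2 * (\<Sum>T\<in>?P. real k - real (card (H \<sigma> T)))
      \<le> (\<Sum>T\<in>?P. Delta loss m (returned t (K \<sigma> T)) (K \<sigma> T) lam (replicate m y))"
    if \<sigma>: "\<sigma> permutes {..<k}" for \<sigma>
  proof -
    \<comment> \<open>Hits have distinct left cells, so the difference counts the undetected
      ones.\<close>
    have "(\<Sum>T\<in>?P. real k - real (card (H \<sigma> T))) = (\<Sum>T\<in>?P. \<Sum>g<k. of_bool (g \<notin> fst ` H \<sigma> T))"
    proof (rule sum.cong[OF refl])
      fix T
      have sub: "fst ` H \<sigma> T \<subseteq> {..<k}"
        by (auto simp: H_def hits_def probed_def dest: cell_pair_bounds)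
      have "inj_on fst (H \<sigma> T)"
        using permutes_inj[OF \<sigma>] by (auto simp: inj_on_def H_def hits_def prod_eq_iff dest: injD)
      then have "card (H \<sigma> T) = card (fst ` H \<sigma> T)"
        by (simp add: card_image)
      moreover have "card ({..<k} - fst ` H \<sigma> T) = k - card (fst ` H \<sigma> T)"
        using card_Diff_subset[OF _ sub] finite_subset[OF sub] by simp
      moreover have "card (fst ` H \<sigma> T) \<le> k"
        using card_mono[OF _ sub] by simp
      moreover have "{..<k} \<inter> {g. g \<notin> fst ` H \<sigma> T} = {..<k} - fst ` H \<sigma> T"
        by auto
      ultimately show "real k - real (card (H \<sigma> T)) = (\<Sum>g<k. of_bool (g \<notin> fst ` H \<sigma> T))"
        by (simp only: sum_of_bool_eq finite_lessThan of_nat_diff)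
    qed
    also have "\<dots> = (\<Sum>g<k. \<Sum>T\<in>?P. of_bool (g \<notin> fst ` H \<sigma> T))"
      by (rule sum.swap)
    also have "\<dots> = (\<Sum>g<k. real (card {T \<in> ?P. g \<notin> fst ` H \<sigma> T}))"
      by (simp only: sum_of_bool_eq finite_Pow_iff finite_lessThan Int_def mem_Collect_eq)
    also have "c / 2 * \<dots> = (\<Sum>g<k. c / 2 * real (card {T \<in> ?P. g \<notin> fst ` H \<sigma> T}))"
      by (rule sum_distrib_left)
    also have "\<dots> \<le> (\<Sum>g<k. \<Sum>T\<in>?P. ?ex \<sigma> T g)"
    proof (rule sum_mono)
      fix g assume "g \<in> {..<k}"
      show "c / 2 * real (card {T \<in> ?P. g \<notin> fst ` H \<sigma> T}) \<le> (\<Sum>T\<in>?P. ?ex \<sigma> T g)"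
      proof (rule sum_flip_ge[where g = g])
        fix T assume T: "T \<in> {T \<in> ?P. g \<notin> fst ` H \<sigma> T}"
        then show "flip g T \<in> {T \<in> ?P. g \<notin> fst ` H \<sigma> T}"
          using unhit[OF \<sigma>, of g T] \<open>g \<in> {..<k}\<close> by (auto simp: flip_def)
        show "c \<le> ?ex \<sigma> T g + ?ex \<sigma> (flip g T) g"
          using unhit[OF \<sigma>, of g T] T group_excess_flip[OF \<open>0 < lam\<close>]
          by (simp add: c_def gap_def)
      qed (auto simp: group_excess_nonneg \<open>0 < lam\<close>)
    qed
    also have "\<dots> = (\<Sum>T\<in>?P. \<Sum>g<k. ?ex \<sigma> T g)"
      by (rule sum.swap)
    also have "\<dots> \<le> (\<Sum>T\<in>?P. Delta loss m (returned t (K \<sigma> T)) (K \<sigma> T) lam (replicate m y))"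
      unfolding K_def
      by (intro sum_mono Delta_cell_label_ge assms \<sigma> t(3)[unfolded K_def]) auto
    finally show ?thesis .
  qed
  \<comment> \<open>Now \<open>T\<close> is fixed and the permutation varies, which is the setting
    of the potential argument.\<close>
  have hits: "(\<Sum>\<sigma>\<in>?S. real (card (H \<sigma> T))) \<le> 6 * real B * fact k / real k" for T
  proof -
    have "(\<Sum>\<sigma>\<in>?S. real (card (H \<sigma> T))) * real k \<le> 6 * real B * fact k"
      unfolding H_def
    proof (rule expected_hits_le[where E = "{..<m} \<times> {..<m}"])
      fix \<sigma> \<sigma>' and e :: "nat \<times> nat"
      assume perm: "\<sigma> permutes {..<k}" "\<sigma>' permutes {..<k}" and "e \<in> {..<m} \<times> {..<m}"
        and same: "\<And>x. cell_pair k n e = Some x \<Longrightarrow> \<sigma> (snd x) = fst x \<longleftrightarrow> \<sigma>' (snd x) = fst x"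
      then obtain a b where ab: "e = (a, b)" "a < m" "b < m"
        by auto
      show "K \<sigma> T $$ e = K \<sigma>' T $$ e"
        unfolding K_def ab(1) cell_label_kernel_index[OF perm(1) ab(2,3)]
          cell_label_kernel_index[OF perm(2) ab(2,3)]
        using same[unfolded ab(1)] by (intro if_cong refl) blast
    qed (use t cell_pair_bounds in auto)
    then show ?thesis
      using \<open>0 < k\<close> by (simp add: field_simps)
  qed
  have "c / 2 * (2 ^ k * fact k * (real k - 6 * real B / real k))
      = c / 2 * (\<Sum>T\<in>?P. fact k * real k - 6 * real B * fact k / real k)"
    by (simp add: card_Pow right_diff_distrib mult_ac)
  also have "\<dots> \<le> c / 2 * (\<Sum>T\<in>?P. \<Sum>\<sigma>\<in>?S. real k - real (card (H \<sigma> T)))"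
    using \<open>0 \<le> c\<close> hits cardS by (intro mult_left_mono sum_mono) (auto simp: sum_subtractf)
  also have "\<dots> = (\<Sum>\<sigma>\<in>?S. c / 2 * (\<Sum>T\<in>?P. real k - real (card (H \<sigma> T))))"
    unfolding sum_distrib_left[symmetric] by (subst sum.swap) (rule refl)
  also have "\<dots> \<le> (\<Sum>\<sigma>\<in>?S. \<Sum>T\<in>?P. Delta loss m (returned t (K \<sigma> T)) (K \<sigma> T) lam (replicate m y))"
    by (intro sum_mono per_perm) auto
  finally show ?thesis
    by (simp add: c_def)
qed

text \<open>The easy half of Yao's principle: for each seed the algorithm is a fixed tree, and a
  bound on the average over a finite family passes to the expectation for one member.\<close>

lemma exists_expected_Delta_ge:
  fixes c :: "'i \<Rightarrow> nat \<Rightarrow> nat" and m :: nat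
  defines "K \<equiv> \<lambda>i. label_kernel m (c i)"
  assumes alg: "budgeted_algorithm M A m Y Ks B" and "y \<in> Y"
    and cvx: "convex_on UNIV (\<lambda>u. loss u y)" and nonneg: "\<And>u. 0 \<le> loss u y" and "0 < lam"
    and I: "finite I" "I \<noteq> {}" "\<And>i. i \<in> I \<Longrightarrow> K i \<in> Ks" and "0 \<le> C"
    and le: "\<And>\<omega>. \<omega> \<in> space M \<Longrightarrow> real (card I) * C \<le>
      (\<Sum>i\<in>I. Delta loss m (returned (A \<omega> (replicate m y)) (K i)) (K i) lam (replicate m y))"
  shows "\<exists>i\<in>I. ennreal C \<le> expected_Delta loss m M A (K i) lam (replicate m y)"
proof -
  let ?y = "replicate m y"
  let ?D = "\<lambda>i \<omega>. Delta loss m (returned (A \<omega> ?y) (K i)) (K i) lam ?y"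
  let ?E = "\<lambda>i. expected_Delta loss m M A (K i) lam ?y"
  have "length ?y = m \<and> set ?y \<subseteq> Y"
    using \<open>y \<in> Y\<close> by auto
  then have carrier: "returned (A \<omega> ?y) (K i) \<in> carrier_vec m" if "\<omega> \<in> space M" "i \<in> I" for \<omega> i
    using alg I(3) that unfolding budgeted_algorithm_def by blast
  have meas: "(\<lambda>\<omega>. returned (A \<omega> ?y) (K i) $ j) \<in> borel_measurable M" if "i \<in> I" "j < m" for i j
    using alg I(3) that \<open>length ?y = m \<and> set ?y \<subseteq> Y\<close> unfolding budgeted_algorithm_def by blast
  \<comment> \<open>The empty selection of blocks gives nonnegativity, so that
    \<open>ennreal\<close> truncates nothing and commutes with the sum.\<close>
  have nonneg_D: "0 \<le> ?D i \<omega>" if "\<omega> \<in> space M" "i \<in> I" for \<omega> i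
    using Delta_label_kernel_ge[where loss = loss and y
        = y, OF cvx nonneg \<open>0 < lam\<close> carrier[OF that], of "{}" "c i"]
    by (simp add: K_def)
  have meas_D: "?D i \<in> borel_measurable M" if "i \<in> I" for i
    unfolding K_def
    by (rule Delta_label_kernel_measurable[where loss = loss and y = y, OF cvx])
      (use carrier meas that in \<open>auto simp: K_def\<close>)
  interpret prob_space M
    using alg unfolding budgeted_algorithm_def by blast
  have "of_nat (card I) * ennreal C = (\<integral>\<^sup>+\<omega>. ennreal (real (card I) * C) \<partial>M)"
    by (simp add: emeasure_space_1 ennreal_mult' ennreal_of_nat_eq_real_of_nat)
  also have "\<dots> \<le> (\<integral>\<^sup>+\<omega>. (\<Sum>i\<in>I. ennreal (?D i \<omega>)) \<partial>M)"
    by (intro nn_integral_mono) (simp add: sum_ennreal nonneg_D le ennreal_leI)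
  also have "\<dots> = (\<Sum>i\<in>I. ?E i)"
    unfolding expected_Delta_def using meas_D by (intro nn_integral_sum) auto
  also have "\<dots> \<le> (\<Sum>i\<in>I. Max (?E ` I))"
    using I by (intro sum_mono Max_ge) auto
  also have "\<dots> = of_nat (card I) * Max (?E ` I)"
    by simp
  finally have "ennreal C \<le> Max (?E ` I)"
    using I by (subst (asm) ennreal_mult_le_mult_iff) auto
  moreover have "Max (?E ` I) \<in> ?E ` I"
    using I by (intro Max_in) auto
  ultimately show ?thesis
    by auto
qed

section \<open>The two cases of the rank parameter\<close>

text \<open>A nonzero budget forces \<open>d \<ge> 5\<close>, hence
  \<open>k = d - 1 \<ge> 4\<close>, and there \<open>6 * B \<le> 9 / 25 * (k + 1)^2\<close> stays
  below \<open>k * (k - (k + 1) / 5)\<close>. A zero budget leaves only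
  \<open>d / 5 \<le> d - 1\<close>.\<close>

lemma undetected_groups_ge:
  assumes "2 \<le> d" "real B < 3 / 50 * (real d)\<^sup>2"
  shows "real d / 5 \<le> real (d - 1) - 6 * real B / real (d - 1)"
proof (cases "B = 0")
  case False
  then have "1 \<le> real B"
    by simp
  then have "50 / 3 < (real d)\<^sup>2"
    using assms(2) by simp
  moreover have "(real d)\<^sup>2 \<le> 4\<^sup>2" if "d \<le> 4"
    using that by (intro power_mono) auto
  ultimately have d: "5 \<le> d"
    by (cases "d \<le> 4") auto
  define k where "k = real (d - 1)"
  have k: "real d = k + 1" "4 \<le> k"
    using d by (auto simp: k_def)
  have "4 * k \<le> k * k"
    using k(2) by (intro mult_right_mono) auto
  moreover have "6 * real B \<le> 9 / 25 * (k + 1)\<^sup>2"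
    using assms(2) unfolding k(1) by simp
  moreover have "(k + 1)\<^sup>2 = k * k + 2 * k + 1" "k * (k - (k + 1) / 5) = 4 / 5 * (k * k) - k / 5"
    by (simp_all add: power2_eq_square field_simps)
  ultimately have "6 * real B \<le> k * (k - (k + 1) / 5)"
    using k(2) by linarith
  then have "6 * real B / k \<le> k - (k + 1) / 5"
    using k(2) by (simp add: pos_divide_le_eq mult.commute)
  then show ?thesis
    unfolding k(1) k_def[symmetric] by linarith
qed (use assms in auto)

text \<open>With only two blocks there is no room for a remainder next to a split pair. Instead, the union of
  two cells and each of the two cells are separated from all other points in turn.\<close>

lemma lower_bound_rank_one:
  fixes M :: "'w measure" and A :: "'w \<Rightarrow> 'y list \<Rightarrow> query_tree"
  assumes alg: "budgeted_algorithm M A m Y (kernel_class 2 m) 0" and "y \<in> Y"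
    and cvx: "convex_on UNIV (\<lambda>u. loss u y)" and nonneg: "\<And>u. 0 \<le> loss u y" and "0 < lam"
    and "0 < n" "2 * n \<le> m" and p: "p = real m / (2 * real n)"
  shows "\<exists>K\<in>kernel_class 2 m.
    ennreal (lam / 18 * gap loss lam 1 p y) \<le> expected_Delta loss m M A K lam (replicate m y)"
proof -
  let ?y = "replicate m y"
  let ?u1 = "u1 loss lam 1 p y" and ?u2 = "u2 loss lam 1 p y"
  define S where "S = (\<lambda>i::nat. if i = 0 then cell n 0 \<union> cell n 1 else if i
      = 1 then cell n 0 else cell n 1)"
  define c where "c = (\<lambda>i a. if a \<in> S i then 0 else 1 :: nat)"
  define w where "w = (\<lambda>i::nat. if i = 0 then ?u2 else ?u1)"
  have S: "S i \<subseteq> {..<m}" "card (S i) = (if i = 0 then n + n else n)" for i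
    using \<open>2 * n \<le> m\<close> by (auto simp: S_def cell_def card_Un_disjoint)
  have fib: "{j \<in> {..<m}. c i j = 0} = S i" for i
    using S(1)[of i] by (auto simp: c_def)
  have K: "label_kernel m (c i) \<in> kernel_class 2 m" for i
  proof (rule label_kernel_in_kernel_class)
    have "card (c i ` {..<m}) \<le> card {0, 1::nat}"
      by (intro card_mono) (auto simp: c_def)
    then show "card (c i ` {..<m}) \<le> 2"
      by simp
  qed
  have pos: "0 < p * lam * real 1"
    using assms by simp
  have half: "lam * real m / (2 * real n) = p * lam * real 1"
    using p \<open>0 < n\<close> by simp
  have full: "lam * real m / (2 * real (n + n)) = p * lam * real 1 / 2"
    using p \<open>0 < n\<close> by simp
  have min1: "is_arg_min (\<lambda>u. loss u y + lam * real m / (2 * real n) * u\<^sup>2) (\<lambda>_. True) ?u1"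
    unfolding half by (rule u1_arg_min[where loss = loss and y = y, OF cvx nonneg pos])
  have min2: "is_arg_min (\<lambda>u. loss u y + lam * real m / (2 * real (n + n)) * u\<^sup>2) (\<lambda>_. True) ?u2"
    unfolding full by (rule u2_arg_min[where loss = loss and y = y, OF cvx nonneg pos])
  have Delta: "lam / 2 * ((\<Sum>j\<in>S i. a $ j) - w i)\<^sup>2 \<le> Delta loss m a (label_kernel m (c i)) lam ?y"
    if a: "a \<in> carrier_vec m" for i a
  proof -
    have "(\<Sum>v\<in>{0}. lam / 2 * (label_sum m (c i) a v - w i)\<^sup>2)
        \<le> Delta loss m a (label_kernel m (c i)) lam ?y"
    proof (rule Delta_label_kernel_ge[where loss = loss and y = y, OF cvx nonneg \<open>0 < lam\<close> a])
      have "card (S i) \<noteq> 0"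
        using S(2)[of i] \<open>0 < n\<close> by simp
      then have "S i \<noteq> {}"
        by (metis card.empty)
      then show "{0} \<subseteq> c i ` {..<m}"
        using fib[of i] by (auto simp: image_iff)
      fix v :: nat assume "v \<in> {0}"
      then have v: "v = 0"
        by simp
      show "is_arg_min
          (\<lambda>u. loss u y + lam * real m / (2 * real (card {j \<in> {..<m}. c i j = v})) * u\<^sup>2)
          (\<lambda>_. True) (w i)"
        unfolding v fib S(2) w_def
        by (cases "i = 0") (simp_all only: simp_thms if_True if_False min1 min2)
    qed
    moreover have "label_sum m (c i) a 0 = (\<Sum>j\<in>S i. a $ j)"
      by (simp only: label_sum_def fib)
    ultimately show ?thesis
      by simp
  qed
  have "\<exists>i\<in>{..<3}. ennreal (lam / 18 * gap loss lam 1 p y)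
      \<le> expected_Delta loss m M A (label_kernel m (c i)) lam ?y"
  proof (rule exists_expected_Delta_ge[where loss = loss and y
      = y, OF alg \<open>y \<in> Y\<close> cvx nonneg \<open>0 < lam\<close>])
    show "0 \<le> lam / 18 * gap loss lam 1 p y"
      using \<open>0 < lam\<close> by (simp add: gap_def)
    show "label_kernel m (c i) \<in> kernel_class 2 m" for i
      by (rule K)
    fix \<omega> assume \<omega>: "\<omega> \<in> space M"
    have "length ?y = m \<and> set ?y \<subseteq> Y"
      using \<open>y \<in> Y\<close> by auto
    then have run: "card (queried (A \<omega> ?y) (label_kernel m (c 0))) \<le> 0"
      "returned (A \<omega> ?y) (label_kernel m (c 0)) \<in> carrier_vec m"
      using alg K[of 0] \<omega> unfolding budgeted_algorithm_def by blast+
    \<comment> \<open>With budget 0 the tree is a leaf, so all three kernels receive the same vector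
      \<open>a\<close>.\<close>
    obtain a where a: "A \<omega> ?y = Return a"
      using run(1) finite_queried by (cases "A \<omega> ?y") (auto simp: card_eq_0_iff)
    let ?L = "\<Sum>j\<in>cell n 0. a $ j" and ?R = "\<Sum>j\<in>cell n 1. a $ j"
    have "(\<Sum>j\<in>S 0. a $ j) = ?L + ?R"
      unfolding S_def by (auto simp: cell_def intro: sum.union_disjoint)
    then have sums: "(\<Sum>i<3. lam / 2 * ((\<Sum>j\<in>S i. a $ j) - w i)\<^sup>2)
        = lam / 2 * ((?L + ?R - ?u2)\<^sup>2 + (?L - ?u1)\<^sup>2 + (?R - ?u1)\<^sup>2)"
      by (simp add: numeral_3_eq_3 w_def S_def distrib_left)
    \<comment> \<open>The three kernels share \<open>lam / 6\<close> times the gap, hence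
      \<open>lam / 18\<close> each on average.\<close>
    have "real (card {..<3::nat}) * (lam / 18 * gap loss lam 1 p y)
        = lam / 2 * ((2 * ?u1 - ?u2)\<^sup>2 / 3)"
      by (simp add: gap_def)
    also have "\<dots> \<le> lam / 2 * ((?L + ?R - ?u2)\<^sup>2 + (?L - ?u1)\<^sup>2 + (?R - ?u1)\<^sup>2)"
      using \<open>0 < lam\<close> by (intro mult_left_mono sum_three_squares_ge) simp
    also have "\<dots> = (\<Sum>i<3. lam / 2 * ((\<Sum>j\<in>S i. a $ j) - w i)\<^sup>2)"
      by (rule sums[symmetric])
    also have "\<dots> \<le> (\<Sum>i<3. Delta loss m a (label_kernel m (c i)) lam ?y)"
      using run(2) a by (intro sum_mono Delta) simp
    finally show "real (card {..<3::nat}) * (lam / 18 * gap loss lam 1 p y)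
        \<le> (\<Sum>i<3. Delta loss m (returned (A \<omega> ?y) (label_kernel m (c i)))
            (label_kernel m (c i)) lam ?y)"
      by (simp only: a returned.simps)
  qed (auto simp: lessThan_empty_iff)
  then show ?thesis
    using K by blast
qed

lemma lower_bound_rank_ge_two:
  fixes M :: "'w measure" and A :: "'w \<Rightarrow> 'y list \<Rightarrow> query_tree"
  assumes alg: "budgeted_algorithm M A m Y (kernel_class (2 * d) m) B" and "y \<in> Y"
    and cvx: "convex_on UNIV (\<lambda>u. loss u y)" and nonneg: "\<And>u. 0 \<le> loss u y" and "0 < lam"
    and "2 \<le> d" and B: "real B < 3 / 50 * (real d)\<^sup>2"
    and "0 < n" "2 * d * n \<le> m" and p: "p = real m / (2 * real n * real d)"
  shows "\<exists>K\<in>kernel_class (2 * d) m.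
    ennreal (1 / 60 * lam * real d * gap loss lam d p y)
      \<le> expected_Delta loss m M A K lam (replicate m y)"
proof -
  let ?y = "replicate m y"
  define k where "k = d - 1"
  let ?K = "\<lambda>\<sigma> T. label_kernel m (cell_label k n \<sigma> T)"
  let ?I = "{\<sigma>. \<sigma> permutes {..<k}} \<times> Pow {..<k}"
  have "0 < k" "2 * k + 1 \<le> 2 * d"
    using \<open>2 \<le> d\<close> by (auto simp: k_def)
  have "2 * k * n \<le> 2 * d * n"
    by (intro mult_right_mono) (auto simp: k_def)
  then have kn: "2 * k * n \<le> m"
    using \<open>2 * d * n \<le> m\<close> by (rule order_trans)
  have "0 < m"
    using kn \<open>0 < k\<close> \<open>0 < n\<close> by (metis gr0I le_zero_eq mult_eq_0_iff zero_neq_numeral)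
  have K: "?K \<sigma> T \<in> kernel_class (2 * d) m" if "\<sigma> permutes {..<k}" for \<sigma> T
    using card_cell_label_le[OF that, of n T m] \<open>2 * k + 1 \<le> 2 * d\<close>
    by (intro label_kernel_in_kernel_class) simp
  have gap: "0 \<le> gap loss lam d p y"
    by (simp add: gap_def)
  have finI: "finite ?I"
    using finite_permutations[of "{..<k}"] by auto
  have cardI: "card ?I = 2 ^ k * fact k"
    using card_permutations[of "{..<k}" k] by (simp add: card_cartesian_product card_Pow)
  have "\<exists>i\<in>?I. ennreal (1 / 60 * lam * real d * gap loss lam d p y)
      \<le> expected_Delta loss m M A (label_kernel m (cell_label k n (fst i) (snd i))) lam ?y"
  proof (rule exists_expected_Delta_ge[where loss = loss and y
      = y, OF alg \<open>y \<in> Y\<close> cvx nonneg \<open>0 < lam\<close> finI])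
    show "?I \<noteq> {}"
      using permutes_id[of "{..<k}"] by blast
    show "?K (fst i) (snd i) \<in> kernel_class (2 * d) m" if "i \<in> ?I" for i
      using that K by auto
    show "0 \<le> 1 / 60 * lam * real d * gap loss lam d p y"
      using gap \<open>0 < lam\<close> by simp
    fix \<omega> assume \<omega>: "\<omega> \<in> space M"
    have "length ?y = m \<and> set ?y \<subseteq> Y"
      using \<open>y \<in> Y\<close> by auto
    then have run: "queried (A \<omega> ?y) (?K \<sigma> T) \<subseteq> {..<m} \<times> {..<m}"
      "card (queried (A \<omega> ?y) (?K \<sigma> T)) \<le> B"
      "returned (A \<omega> ?y) (?K \<sigma> T) \<in> carrier_vec m"
      if "\<sigma> permutes {..<k}" for \<sigma> T
      using alg K[OF that, of T] \<omega> unfolding budgeted_algorithm_def by blast+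
    \<comment> \<open>The factor \<open>1 / 60\<close> is \<open>1 / 12\<close> times
      \<open>1 / 5\<close>, with \<open>d / 5\<close> a lower bound for the average number of
      undetected pairs.\<close>
    have "real (card ?I) * (1 / 60 * lam * real d * gap loss lam d p y)
        = lam / 12 * gap loss lam d p y * (2 ^ k * fact k * (real d / 5))"
      by (simp add: cardI)
    also have "\<dots>
        \<le> lam / 12 * gap loss lam d p y * (2 ^ k * fact k * (real k - 6 * real B / real k))"
      using undetected_groups_ge[OF \<open>2 \<le> d\<close> B] gap \<open>0 < lam\<close>
      unfolding k_def by (intro mult_left_mono) auto
    also have "\<dots> \<le> (\<Sum>\<sigma> | \<sigma> permutes {..<k}. \<Sum>T\<in>Pow {..<k}.
        Delta loss m (returned (A \<omega> ?y) (?K \<sigma> T)) (?K \<sigma> T) lam ?y)"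
      using \<open>2 \<le> d\<close>
      by (intro sum_Delta_cell_label_ge cvx nonneg p run kn \<open>0 < lam\<close> \<open>0 < n\<close> \<open>0 < m\<close> \<open>0 < k\<close>) auto
    also have "\<dots> = (\<Sum>i\<in>?I. Delta loss m (returned (A \<omega> ?y) (?K (fst i) (snd i)))
        (?K (fst i) (snd i)) lam ?y)"
      by (simp add: sum.cartesian_product case_prod_unfold)
    finally show "real (card ?I) * (1 / 60 * lam * real d * gap loss lam d p y)
        \<le> (\<Sum>i\<in>?I. Delta loss m (returned (A \<omega> ?y) (?K (fst i) (snd i)))
            (?K (fst i) (snd i)) lam ?y)" .
  qed
  then show ?thesis
    using K by fastforce
qed

theorem theorem2:
  fixes Y :: "'y set" and loss :: "real \<Rightarrow> 'y \<Rightarrow> real" and lam :: real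
    and d m B :: nat
    and M :: "'w measure" and A :: "'w \<Rightarrow> 'y list \<Rightarrow> query_tree"
  assumes "\<And>y. y \<in> Y \<Longrightarrow> convex_on UNIV (\<lambda>u. loss u y)"
    and "\<And>u y. y \<in> Y \<Longrightarrow> 0 \<le> loss u y"
    and "0 < lam"
    and "1 \<le> d"
    and "2 ^ 7 * d \<le> m"
    and "real B < 3 / 50 * (real d)\<^sup>2"
    and maximum_exists: "\<And>p. p \<in> {1/2..2} \<Longrightarrow> \<exists>y. is_arg_max (gap loss lam d p) (\<lambda>y. y \<in> Y) y"
    and "budgeted_algorithm M A m Y (kernel_class (2 * d) m) B"
  shows "\<exists>K\<in>kernel_class (2 * d) m. \<exists>y. length y = m \<and> set y \<subseteq> Y \<and>
           ennreal (1 / 60 * lam * real d * (INF p\<in>{1/2..2}. SUP y\<in>Y. gap loss lam d p y))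
             \<le> expected_Delta loss m M A K lam y"
proof -
  \<comment> \<open>The largest cell size for which \<open>2 * d\<close> cells fit into
    \<open>m\<close> points; \<open>p\<close> absorbs the rounding and lies between 1 and 2.\<close>
  define n where "n = m div (2 * d)"
  define p where "p = real m / (2 * real n * real d)"
  have n: "2 * d * n \<le> m" "m < 2 * d * n + 2 * d"
    using \<open>1 \<le> d\<close> times_div_less_eq_dividend[of "2 * d" m] dividend_less_times_div[of "2 * d" m]
    unfolding n_def by (simp_all only: add.commute)
  have "2 * d * 1 \<le> m"
    using \<open>2 ^ 7 * d \<le> m\<close> by simp
  then have "1 \<le> n"
    using \<open>1 \<le> d\<close> unfolding n_def by (simp add: less_eq_div_iff_mult_less_eq)
  then have "2 * d * 1 \<le> 2 * d * n"
    by (intro mult_left_mono) auto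
  then have "m \<le> 2 * (2 * d * n)"
    using n(2) by linarith
  then have "real m \<le> real (2 * (2 * d * n))" "real (2 * d * n) \<le> real m"
    using n(1) by (simp_all only: of_nat_le_iff)
  then have "real m \<le> 2 * (2 * real n * real d)" "2 * real n * real d \<le> real m"
    by (simp_all add: mult_ac)
  then have p_range: "p \<in> {1/2..2}"
    using \<open>1 \<le> n\<close> \<open>1 \<le> d\<close> by (auto simp: p_def field_simps)
  \<comment> \<open>The worst target for this \<open>p\<close>, to be used at every point; it does
    not depend on the algorithm.\<close>
  obtain y where y: "y \<in> Y" "\<And>z. z \<in> Y \<Longrightarrow> gap loss lam d p z \<le> gap loss lam d p y"
    using maximum_exists[OF p_range] by (auto simp: is_arg_max_linorder)
  have cvx: "convex_on UNIV (\<lambda>u. loss u y)" and nonneg: "\<And>u. 0 \<le> loss u y"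
    using assms(1,2) y(1) by blast+
  \<comment> \<open>Specialising the infimum to \<open>p\<close> needs a common lower bound of the
    suprema. Each supremum is over a set bounded above, as its maximum is attained.\<close>
  have "(INF p\<in>{1/2..2}. SUP y\<in>Y. gap loss lam d p y) \<le> (SUP y\<in>Y. gap loss lam d p y)"
  proof (rule cINF_lower[OF _ p_range])
    show "bdd_below ((\<lambda>p. SUP y\<in>Y. gap loss lam d p y) ` {1/2..2})"
    proof (rule bdd_belowI2)
      fix q :: real assume "q \<in> {1/2..2}"
      then obtain z where z: "z \<in> Y" "\<And>x. x \<in> Y \<Longrightarrow> gap loss lam d q x \<le> gap loss lam d q z"
        using maximum_exists by (auto simp: is_arg_max_linorder)
      have "0 \<le> gap loss lam d q z"
        by (simp add: gap_def)
      also have "\<dots> \<le> (SUP y\<in>Y. gap loss lam d q y)"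
        using z by (intro cSUP_upper bdd_aboveI2)
      finally show "0 \<le> (SUP y\<in>Y. gap loss lam d q y)" .
    qed
  qed
  also have "\<dots> \<le> gap loss lam d p y"
    using y by (intro cSUP_least) auto
  finally have le: "1 / 60 * lam * real d * (INF p\<in>{1/2..2}. SUP y\<in>Y. gap loss lam d p y)
      \<le> 1 / 60 * lam * real d * gap loss lam d p y"
    using \<open>0 < lam\<close> by (intro mult_left_mono) auto
  have "\<exists>K\<in>kernel_class (2 * d) m. ennreal (1 / 60 * lam * real d * gap loss lam d p y)
      \<le> expected_Delta loss m M A K lam (replicate m y)"
  proof (cases "d = 1")
    case True
    \<comment> \<open>For \<open>d = 1\<close> the natural number \<open>B\<close> is below
      \<open>3 / 50\<close>.\<close>
    have "B = 0"
      using assms(6) True by simp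
    have "\<exists>K\<in>kernel_class 2 m. ennreal (lam / 18 * gap loss lam 1 p y)
        \<le> expected_Delta loss m M A K lam (replicate m y)"
    proof (rule lower_bound_rank_one[where loss = loss and y = y])
      show "budgeted_algorithm M A m Y (kernel_class 2 m) 0"
        using assms(8) unfolding \<open>B = 0\<close> True by simp
      show "p = real m / (2 * real n)" "0 < n" "2 * n \<le> m"
        using True n(1) \<open>1 \<le> n\<close> by (simp_all add: p_def)
    qed (fact y(1) cvx nonneg \<open>0 < lam\<close>)+
    moreover have "1 / 60 * lam * real d * gap loss lam d p y \<le> lam / 18 * gap loss lam 1 p y"
      using True \<open>0 < lam\<close> by (simp add: gap_def)
    ultimately show ?thesis
      unfolding True mult_1_right by (meson ennreal_leI order_trans)
  next
    case False
    show ?thesis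
    proof (rule lower_bound_rank_ge_two[where loss = loss and y = y])
      show "2 \<le> d" "0 < n"
        using False \<open>1 \<le> d\<close> \<open>1 \<le> n\<close> by simp_all
    qed (fact assms(8) y(1) cvx nonneg \<open>0 < lam\<close> assms(6) n(1) p_def)+
  qed
  then obtain K where K: "K \<in> kernel_class (2 * d) m"
    "ennreal (1 / 60 * lam * real d * gap loss lam d p y)
      \<le> expected_Delta loss m M A K lam (replicate m y)"
    by blast
  have "ennreal (1 / 60 * lam * real d * (INF p\<in>{1/2..2}. SUP y\<in>Y. gap loss lam d p y))
      \<le> expected_Delta loss m M A K lam (replicate m y)"
    using ennreal_leI[OF le] K(2) by (rule order_trans)
  then show ?thesis
    using K(1) y(1) by (intro bexI[of _ K] exI[of _ "replicate m y"]) auto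
qed

end
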